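(* Let $N\ge1$, $0<s<1$, let $\Omega\subset\mathbb{R}^N$ be a bounded domain with Lipschitz continuous boundary, $Z_D:=L^2(\mathbb{R}^N\setminus\Omega)$, $U_D:=L^2(\Omega)$, and $\xi>0$. Let $Z_{ad,D}$ be a closed and convex subset of $Z_D$ and let $J:U_D\to\mathbb{R}$ be weakly lower-semicontinuous. Let $\mathcal{Z}$ be an open set in $Z_D$ such that $Z_{ad,D}\subset\mathcal{Z}$. Let $u\mapsto J(u):U_D\to\mathbb{R}$ be continuously Fréchet differentiable with $J'(u)\in U_D$. If $\bar z$ is a minimizer over $Z_{ad,D}$ of $$\mathcal{J}(z):=J(Sz)+\frac{\xi}{2}\|z\|^2_{Z_D},$$ then, with $\bar u:=S\bar z$, the first order necessary optimality conditions are given by $$\left(-\mathcal{N}_s\bar p+\xi\bar z,\,z-\bar z\right)_{L^2(\mathbb{R}^N\setminus\Omega)}\ge0\quad\text{for all } z\in Z_{ad,D},\qquad(\ast)$$ where $\bar p\in W^{s,2}_0(\overline\Omega)$ is the weak solution of the adjoint equation $$(-\Delta)^s\bar p=J'(\bar u)\ \text{ in }\Omega,\qquad\bar p=0\ \text{ in }\mathbb{R}^N\setminus\Omega.$$ Equivalently, $(\ast)$ can be written as $$\bar z=\mathcal{P}_{Z_{ad,D}}\left(\frac1\xi\mathcal{N}_s\bar p\right),$$ where $\mathcal{P}_{Z_{ad,D}}$ is the projection onto the set $Z_{ad,D}$. If $J$ is convex, then $(\ast)$ is a sufficient condition (for $\bar z\in Z_{ad,D}$ to be a minimizer of $\mathcal{J}$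 over $Z_{ad,D}$).
   Context: $W^{s,2}_0(\overline\Omega):=\{u\in W^{s,2}(\mathbb{R}^N):u=0\text{ in }\mathbb{R}^N\setminus\Omega\}$ with $W^{s,2}$ the standard fractional Sobolev space. $C_{N,s}:=\frac{s2^{2s}\Gamma\left(\frac{2s+N}{2}\right)}{\pi^{N/2}\Gamma(1-s)}$; $(-\Delta)^su(x)=C_{N,s}\,\mathrm{P.V.}\int_{\mathbb{R}^N}\frac{u(x)-u(y)}{|x-y|^{N+2s}}dy$; $\mathcal{N}_su(x)=C_{N,s}\int_\Omega\frac{u(x)-u(y)}{|x-y|^{N+2s}}dy$ for $x\in\mathbb{R}^N\setminus\overline\Omega$. For $w\in L^2(\Omega)$, the weak solution $p\in W^{s,2}_0(\overline\Omega)$ of $(-\Delta)^sp=w$ in $\Omega$, $p=0$ in $\mathbb{R}^N\setminus\Omega$ satisfies $\frac{C_{N,s}}{2}\int_{\mathbb{R}^N}\int_{\mathbb{R}^N}\frac{(p(x)-p(y))(\varphi(x)-\varphi(y))}{|x-y|^{N+2s}}dxdy=\int_\Omega w\varphi\,dx$ for all $\varphi\in W^{s,2}_0(\overline\Omega)$. For $v\in W^{s,2}_0(\overline\Omega)$, $(-\Delta)^sv\in L^2(\Omega)$ means that $v$ is such a weak solution for some $w\in L^2(\Omega)$, and then $(-\Delta)^sv:=w$. For $z\in L^2(\mathbb{R}^N\setminus\Omega)$, the very-weak solution of $(-\Delta)^su=0$ in $\Omega$, $u=z$ in $\mathbb{R}^N\setminus\Omega$ is the function $u\in L^2(\mathbb{R}^N)$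 with $u=z$ a.e. in $\mathbb{R}^N\setminus\Omega$ and $\int_\Omega u(-\Delta)^sv\,dx=-\int_{\mathbb{R}^N\setminus\Omega}z\,\mathcal{N}_sv\,dx$ for every $v\in V:=\{v\in W^{s,2}_0(\overline\Omega):(-\Delta)^sv\in L^2(\Omega)\}$. The control-to-state map $S:Z_D\to U_D$ sends $z$ to the restriction to $\Omega$ of this solution; the paper establishes beforehand that $S$ is well-defined, linear and continuous. $J'(u)$ is identified with an element of $L^2(\Omega)$ via the Riesz representation.
   Formalization: The well-definedness of S on all of L²(ℝᴺ∖Ω) is assumed explicitly: every z has a very-weak solution, with z·N_s v integrable. Without this, S and (∗) can be undefined, e.g. for the unit ball and s ≥ 1/2, where N_s v need not be in L². *)

theory Defs
  imports "HOL-Analysis.Analysis"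
begin

section \<open>The Hilbert space of square-integrable functions\<close>

text \<open>
  \<open>'a L2\<close> is $L^2(\mathbb{R}^N)$ with $N$ = \<open>DIM('a)\<close>: square-integrable functions modulo equality
  almost everywhere. Every Lebesgue measurable function is a.e. equal to a Borel measurable
  one, so taking \<open>lborel\<close> rather than \<open>lebesgue\<close> gives the same space of classes.
\<close>

definition square_integrable :: "('a::euclidean_space \<Rightarrow> real) \<Rightarrow> bool" where
  "square_integrable f \<longleftrightarrow>
     f \<in> borel_measurable lborel \<and> integrable lborel (\<lambda>x. (f x)\<^sup>2)"

definition L2_rel :: "('a::euclidean_space \<Rightarrow> real) \<Rightarrow> ('a \<Rightarrow> real) \<Rightarrow> bool" where
  "L2_rel f g \<longleftrightarrow> square_integrable f \<and> square_integrable g \<and> (AE x in lborel. f x = g x)"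

lemma L2_rel_eqI:
  assumes "square_integrable f" "\<And>x. f x = g x"
  shows "L2_rel f g"
proof -
  have "f = g" using assms(2) by (rule ext)
  then show ?thesis using assms(1) by (simp add: L2_rel_def)
qed

lemma square_integrable_mult:
  fixes f g :: "'a::euclidean_space \<Rightarrow> real"
  assumes "square_integrable f" "square_integrable g"
  shows "integrable lborel (\<lambda>x. f x * g x)"
proof (rule Bochner_Integration.integrable_bound)
  show "integrable lborel (\<lambda>x. (f x)\<^sup>2 + (g x)\<^sup>2)"
    using assms by (auto simp: square_integrable_def)
  show "(\<lambda>x. f x * g x) \<in> borel_measurable lborel"
    using assms by (auto simp: square_integrable_def)
  have "\<bar>a * b\<bar> \<le> a\<^sup>2 + b\<^sup>2" for a b :: real
    using sum_squares_bound[of "\<bar>a\<bar>" "\<bar>b\<bar>"] zero_le_power2[of a] zero_le_power2[of b]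
    by (simp add: abs_mult) (use mult_nonneg_nonneg[of "\<bar>a\<bar>" "\<bar>b\<bar>"] in linarith)
  then show "AE x in lborel. norm (f x * g x) \<le> norm ((f x)\<^sup>2 + (g x)\<^sup>2)"
    by (auto simp: abs_of_nonneg intro!: AE_I2)
qed

lemma square_integrable_zero: "square_integrable (\<lambda>x. 0)"
  by (simp add: square_integrable_def)

lemma square_integrable_add:
  assumes "square_integrable f" "square_integrable g"
  shows "square_integrable (\<lambda>x. f x + g x)"
  using assms square_integrable_mult[OF assms]
  unfolding square_integrable_def power2_sum by (auto simp: mult.assoc)

lemma square_integrable_scale:
  assumes "square_integrable f"
  shows "square_integrable (\<lambda>x. c * f x)"
  using assms unfolding square_integrable_def by (auto simp: power_mult_distrib)

lemma square_integrable_uminus: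
  assumes "square_integrable f"
  shows "square_integrable (\<lambda>x. - f x)"
  using square_integrable_scale[OF assms, of "-1"] by simp

lemma square_integrable_diff:
  assumes "square_integrable f" "square_integrable g"
  shows "square_integrable (\<lambda>x. f x - g x)"
  using square_integrable_add[OF assms(1) square_integrable_uminus[OF assms(2)]] by simp

quotient_type (overloaded) 'a L2 = "'a::euclidean_space \<Rightarrow> real" / partial: L2_rel
proof (rule part_equivpI)
  show "\<exists>f::'a \<Rightarrow> real. L2_rel f f"
    using square_integrable_zero by (auto simp: L2_rel_def)
  show "symp L2_rel"
    by (rule sympI) (auto simp: L2_rel_def elim: AE_mp)
  show "transp L2_rel"
    by (rule transpI) (auto simp: L2_rel_def elim: AE_mp)
qed

instantiation L2 :: (euclidean_space) real_vector
begin

lift_definition zero_L2 :: "'a L2" is "\<lambda>x. 0"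
  by (simp add: L2_rel_def square_integrable_zero)

lift_definition plus_L2 :: "'a L2 \<Rightarrow> 'a L2 \<Rightarrow> 'a L2" is "\<lambda>f g x. f x + g x"
  by (auto simp: L2_rel_def intro!: square_integrable_add)

lift_definition minus_L2 :: "'a L2 \<Rightarrow> 'a L2 \<Rightarrow> 'a L2" is "\<lambda>f g x. f x - g x"
  by (auto simp: L2_rel_def intro!: square_integrable_diff)

lift_definition uminus_L2 :: "'a L2 \<Rightarrow> 'a L2" is "\<lambda>f x. - f x"
  by (auto simp: L2_rel_def intro!: square_integrable_uminus)

lift_definition scaleR_L2 :: "real \<Rightarrow> 'a L2 \<Rightarrow> 'a L2" is "\<lambda>c f x. c * f x"
  by (auto simp: L2_rel_def intro!: square_integrable_scale)

instance
proof
  fix u v w :: "'a L2" and a b :: real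
  show "u + v + w = u + (v + w)" "u + v = v + u" "0 + u = u" "- u + u = 0" "u - v = u + - v"
    "a *\<^sub>R (u + v) = a *\<^sub>R u + a *\<^sub>R v" "(a + b) *\<^sub>R u = a *\<^sub>R u + b *\<^sub>R u"
    "a *\<^sub>R b *\<^sub>R u = (a * b) *\<^sub>R u" "1 *\<^sub>R u = u"
    by (transfer, rule L2_rel_eqI, (auto simp: L2_rel_def
        intro!: square_integrable_add square_integrable_diff square_integrable_uminus
          square_integrable_scale square_integrable_zero)[1], simp add: algebra_simps)+
qed

end

instantiation L2 :: (euclidean_space) real_inner
begin

lift_definition inner_L2 :: "'a L2 \<Rightarrow> 'a L2 \<Rightarrow> real" is "\<lambda>f g. LINT x|lborel. f x * g x"
proof -
  fix f f' g g' :: "'a \<Rightarrow> real"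
  assume *: "L2_rel f f'" "L2_rel g g'"
  show "(LINT x|lborel. f x * g x) = (LINT x|lborel. f' x * g' x)"
  proof (rule integral_cong_AE)
    have "AE x in lborel. f x = f' x" "AE x in lborel. g x = g' x"
      using * by (auto simp: L2_rel_def)
    then show "AE x in lborel. f x * g x = f' x * g' x" by eventually_elim simp
  qed (use * in \<open>auto simp: L2_rel_def square_integrable_def\<close>)
qed

definition norm_L2 :: "'a L2 \<Rightarrow> real" where "norm_L2 u = sqrt (u \<bullet> u)"

definition dist_L2 :: "'a L2 \<Rightarrow> 'a L2 \<Rightarrow> real" where "dist_L2 u v = norm (u - v)"

definition sgn_L2 :: "'a L2 \<Rightarrow> 'a L2" where "sgn_L2 u = u /\<^sub>R norm u"

definition uniformity_L2 :: "('a L2 \<times> 'a L2) filter" where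
  "uniformity_L2 = (INF e\<in>{0<..}. principal {(u, v). dist u v < e})"

definition open_L2 :: "'a L2 set \<Rightarrow> bool" where
  "open_L2 U \<longleftrightarrow> (\<forall>u\<in>U. \<forall>\<^sub>F (u', v) in uniformity. u' = u \<longrightarrow> v \<in> U)"

instance
proof
  fix u v w :: "'a L2" and a :: real and U :: "'a L2 set"
  show "dist u v = norm (u - v)" "sgn u = u /\<^sub>R norm u" "norm u = sqrt (u \<bullet> u)"
    "uniformity = (INF e\<in>{0<..}. principal {(u, v :: 'a L2). dist u v < e})"
    "open U \<longleftrightarrow> (\<forall>u\<in>U. \<forall>\<^sub>F (u', v) in uniformity. u' = u \<longrightarrow> v \<in> U)"
    by (simp_all only: dist_L2_def sgn_L2_def norm_L2_def uniformity_L2_def open_L2_def)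
  show "u \<bullet> v = v \<bullet> u" by transfer (simp add: mult.commute)
  show "(u + v) \<bullet> w = u \<bullet> w + v \<bullet> w"
    by transfer (simp add: L2_rel_def distrib_right square_integrable_mult)
  show "(a *\<^sub>R u) \<bullet> v = a * (u \<bullet> v)"
    by transfer (simp add: mult.assoc)
  show "0 \<le> u \<bullet> u" by transfer simp
  show "u \<bullet> u = 0 \<longleftrightarrow> u = 0"
  proof transfer
    fix f :: "'a \<Rightarrow> real" assume "L2_rel f f"
    then have f: "square_integrable f" by (simp add: L2_rel_def)
    have "(LINT x|lborel. f x * f x) = 0 \<longleftrightarrow> (AE x in lborel. f x * f x = 0)"
      by (rule integral_nonneg_eq_0_iff_AE) (auto intro: square_integrable_mult f)
    then show "(LINT x|lborel. f x * f x) = 0 \<longleftrightarrow> L2_rel f (\<lambda>x. 0)"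
      by (simp add: L2_rel_def f square_integrable_zero)
  qed
qed

end

text \<open>$L^2(A)$, embedded isometrically into $L^2(\mathbb{R}^N)$ by extension by zero.\<close>

definition L2_on :: "'a::euclidean_space set \<Rightarrow> 'a L2 set" where
  "L2_on A = {u. AE x in lborel. x \<notin> A \<longrightarrow> rep_L2 u x = 0}"

definition restrict_L2 :: "'a::euclidean_space set \<Rightarrow> 'a L2 \<Rightarrow> 'a L2" where
  "restrict_L2 A u = abs_L2 (\<lambda>x. indicator A x * rep_L2 u x)"

text \<open>
  Sequential weak lower semicontinuity, the form used by the direct method. It is implied by
  lower semicontinuity for the weak topology, so assuming it is the weaker hypothesis.
\<close>

definition weakly_lsc_on :: "'a::real_inner set \<Rightarrow> ('a \<Rightarrow> real) \<Rightarrow> bool" where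
  "weakly_lsc_on U J \<longleftrightarrow>
     (\<forall>X u. (\<forall>n. X n \<in> U) \<longrightarrow> u \<in> U \<longrightarrow>
        (\<forall>\<phi>\<in>U. (\<lambda>n. X n \<bullet> \<phi>) \<longlonglongrightarrow> u \<bullet> \<phi>) \<longrightarrow>
        ereal (J u) \<le> liminf (\<lambda>n. ereal (J (X n))))"

definition projection :: "'a::metric_space set \<Rightarrow> 'a \<Rightarrow> 'a" where
  "projection C q = arg_min_on (dist q) C"


section \<open>Lipschitz boundaries\<close>

text \<open>
  Near each boundary point, \<open>\<Omega>\<close> is the strict epigraph, in the direction of a unit vector \<open>e\<close>,
  of a Lipschitz function \<open>\<gamma>\<close> on the hyperplane orthogonal to \<open>e\<close>.
\<close>

definition lipschitz_boundary :: "'a::euclidean_space set \<Rightarrow> bool" where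
  "lipschitz_boundary \<Omega> \<longleftrightarrow>
     (\<forall>x0\<in>frontier \<Omega>. \<exists>r>0. \<exists>e \<gamma> L. norm e = 1 \<and> L-lipschitz_on {h. h \<bullet> e = 0} \<gamma> \<and>
        \<Omega> \<inter> ball x0 r = {x \<in> ball x0 r. \<gamma> (x - (x \<bullet> e) *\<^sub>R e) < x \<bullet> e})"


section \<open>Fractional Sobolev spaces and the fractional Laplacian\<close>

definition frac_const :: "nat \<Rightarrow> real \<Rightarrow> real" where
  "frac_const N s =
     s * 2 powr (2 * s) * Gamma ((2 * s + real N) / 2) / (pi powr (real N / 2) * Gamma (1 - s))"

definition W_s2 :: "real \<Rightarrow> 'a::euclidean_space L2 set" where
  "W_s2 s = {u. integrable (lborel \<Otimes>\<^sub>M lborel) (\<lambda>(x, y).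
     (rep_L2 u x - rep_L2 u y)\<^sup>2 / norm (x - y) powr (real DIM('a) + 2 * s))}"

definition W0_s2 :: "real \<Rightarrow> 'a::euclidean_space set \<Rightarrow> 'a L2 set" where
  "W0_s2 s \<Omega> = {u \<in> W_s2 s. AE x in lborel. x \<in> - \<Omega> \<longrightarrow> rep_L2 u x = 0}"

definition frac_form :: "real \<Rightarrow> 'a::euclidean_space L2 \<Rightarrow> 'a L2 \<Rightarrow> real" where
  "frac_form s u \<phi> = frac_const DIM('a) s / 2 *
     (LINT (x, y)|(lborel \<Otimes>\<^sub>M lborel).
        (rep_L2 u x - rep_L2 u y) * (rep_L2 \<phi> x - rep_L2 \<phi> y)
          / norm (x - y) powr (real DIM('a) + 2 * s))"

text \<open>
  \<open>weak_solution s \<Omega> w p\<close>: \<open>p\<close> solves $(-\Delta)^s p = w$ in \<open>\<Omega>\<close>, $p = 0$ outside \<open>\<Omega>\<close>. For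
  \<open>w \<in> L2_on \<Omega>\<close> this is at the same time the meaning of $(-\Delta)^s p = w \in L^2(\Omega)$.
\<close>

definition weak_solution ::
    "real \<Rightarrow> 'a::euclidean_space set \<Rightarrow> 'a L2 \<Rightarrow> 'a L2 \<Rightarrow> bool" where
  "weak_solution s \<Omega> w p \<longleftrightarrow> p \<in> W0_s2 s \<Omega> \<and>
     (\<forall>\<phi>\<in>W0_s2 s \<Omega>. frac_form s p \<phi> = (LINT x:\<Omega>|lborel. rep_L2 w x * rep_L2 \<phi> x))"

definition nonlocal_normal ::
    "real \<Rightarrow> 'a::euclidean_space set \<Rightarrow> 'a L2 \<Rightarrow> 'a \<Rightarrow> real" where
  "nonlocal_normal s \<Omega> u x = frac_const DIM('a) s *
     (LINT y:\<Omega>|lborel. (rep_L2 u x - rep_L2 u y) / norm (x - y) powr (real DIM('a) + 2 * s))"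

text \<open>
  The class of the nonlocal normal derivative in $L^2(\mathbb{R}^N \setminus \Omega)$, extended by zero. It is
  meaningful only if the zero extension \<open>ext_nonlocal_normal s \<Omega> u\<close> is \<open>square_integrable\<close>.
\<close>

definition ext_nonlocal_normal ::
    "real \<Rightarrow> 'a::euclidean_space set \<Rightarrow> 'a L2 \<Rightarrow> 'a \<Rightarrow> real" where
  "ext_nonlocal_normal s \<Omega> u x = indicator (- \<Omega>) x * nonlocal_normal s \<Omega> u x"

definition nonlocal_normal_L2 ::
    "real \<Rightarrow> 'a::euclidean_space set \<Rightarrow> 'a L2 \<Rightarrow> 'a L2" where
  "nonlocal_normal_L2 s \<Omega> u = abs_L2 (ext_nonlocal_normal s \<Omega> u)"


section \<open>The exterior control problem\<close>

text \<open>
  The quantification over pairs \<open>v\<close>, \<open>w\<close> ranges over all \<open>v \<in> V\<close> with $w = (-\Delta)^s v$. The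
  integrability clause makes the right-hand side meaningful, since the Bochner integral of a
  non-integrable function is 0 by convention.
\<close>

definition very_weak_solution ::
    "real \<Rightarrow> 'a::euclidean_space set \<Rightarrow> 'a L2 \<Rightarrow> 'a L2 \<Rightarrow> bool" where
  "very_weak_solution s \<Omega> z u \<longleftrightarrow>
     (AE x in lborel. x \<in> - \<Omega> \<longrightarrow> rep_L2 u x = rep_L2 z x) \<and>
     (\<forall>v. \<forall>w\<in>L2_on \<Omega>. weak_solution s \<Omega> w v \<longrightarrow>
        set_integrable lborel (- \<Omega>) (\<lambda>x. rep_L2 z x * nonlocal_normal s \<Omega> v x) \<and>
        (LINT x:\<Omega>|lborel. rep_L2 u x * rep_L2 w x) =
          - (LINT x:- \<Omega>|lborel. rep_L2 z x * nonlocal_normal s \<Omega> v x))"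

definition control_to_state ::
    "real \<Rightarrow> 'a::euclidean_space set \<Rightarrow> 'a L2 \<Rightarrow> 'a L2" where
  "control_to_state s \<Omega> z = restrict_L2 \<Omega> (THE u. very_weak_solution s \<Omega> z u)"

definition reduced_cost ::
    "real \<Rightarrow> 'a::euclidean_space set \<Rightarrow> real \<Rightarrow> ('a L2 \<Rightarrow> real) \<Rightarrow> 'a L2 \<Rightarrow> real" where
  "reduced_cost s \<Omega> \<xi> J z = J (control_to_state s \<Omega> z) + \<xi> / 2 * (norm z)\<^sup>2"

definition variational_inequality ::
    "real \<Rightarrow> 'a::euclidean_space set \<Rightarrow> real \<Rightarrow> 'a L2 set \<Rightarrow> 'a L2 \<Rightarrow> 'a L2 \<Rightarrow> bool" where
  "variational_inequality s \<Omega> \<xi> Zad zb p \<longleftrightarrow>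
     (\<forall>z\<in>Zad. (- nonlocal_normal_L2 s \<Omega> p + \<xi> *\<^sub>R zb) \<bullet> (z - zb) \<ge> 0)"

end

theory Submission
  imports Defs
begin

text \<open>
  The reduced cost is a differentiable function composed with a linear map, plus a quadratic term. On the
  segment from $\bar z$ to $z$ its slope at $\bar z$ is
  $(J'(\bar u), S(z - \bar z)) + \xi (\bar z, z - \bar z)$, and the adjoint state turns the first term into
  $(-\mathcal{N}_s \bar p, z - \bar z)$ (\<open>control_to_state_adjoint\<close>). The variational inequality is
  therefore the statement that no admissible segment has a negative slope. It is necessary at a
  minimizer, it is sufficient for convex $J$ because the quadratic term is convex as well, and after
  division by \<open>\<xi>\<close> it is the usual characterization of a projection in a Hilbert space
  (\<open>projection_iff_variational_inequality\<close>).

  The analysis lies in making these objects meaningful. Weak solutions exist and are unique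
  (\<open>weak_solution_exists_unique\<close>) by a minimization argument in the energy space, which rests on
  completeness of $L^2$, on closedness of the graph of the difference quotient, and on a Poincare
  inequality for functions vanishing outside a bounded set. Existence of weak solutions for every
  right-hand side in turn makes very weak solutions unique, so $S$ is a well-defined
  linear map (\<open>control_to_state_comb\<close>). Finally, $\mathcal{N}_s \bar p$ is square-integrable outside
  \<open>\<Omega>\<close> (\<open>square_integrable_nonlocal_normal\<close>), since its products with all square-integrable exterior data are
  integrable.
\<close>

section \<open>Quadratic minimization over complete convex sets\<close>

text \<open>
  The common source of the first order inequalities below: each is this one-sided test for a function
  of the parameter along a segment that is smallest at the starting point of the segment.
\<close>

lemma right_minimum_derivative_nonneg:
  fixes f :: "real \<Rightarrow> real"
  assumes deriv: "(f has_real_derivative D) (at 0)"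
    and min: "\<And>t. 0 \<le> t \<Longrightarrow> t \<le> 1 \<Longrightarrow> f 0 \<le> f t"
  shows "0 \<le> D"
proof (rule ccontr)
  assume "\<not> 0 \<le> D"
  then have "D < 0" by simp
  then obtain d where d: "d > 0" "\<forall>h>0. h < d \<longrightarrow> f (0 + h) < f 0"
    using DERIV_neg_dec_right[OF deriv] by blast
  define h where "h = min 1 (d / 2)"
  have "0 < h" "h < d" "h \<le> 1" using d(1) by (auto simp: h_def min_def)
  then have "f h < f 0" "f 0 \<le> f h" using d(2) min[of h] by auto
  then show False by simp
qed

text \<open>
  The derivative is taken relative to a subspace, which may have empty interior; along a line inside
  the subspace it still yields an ordinary two-sided derivative at 0.
\<close>

lemma directional_derivative:
  fixes J :: "'v::real_normed_vector \<Rightarrow> real"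
  assumes "(J has_derivative J') (at u within V)" "subspace V" "u \<in> V" "h \<in> V"
  shows "((\<lambda>t. J (u + t *\<^sub>R h)) has_real_derivative J' h) (at 0)"
proof -
  have lin: "((\<lambda>t::real. u + t *\<^sub>R h) has_derivative (\<lambda>t. t *\<^sub>R h)) (at 0)"
    by (auto intro!: derivative_eq_intros)
  have sub: "range (\<lambda>t::real. u + t *\<^sub>R h) \<subseteq> V"
    using assms by (auto intro: subspace_add subspace_scale)
  have "(J has_derivative J') (at (u + 0 *\<^sub>R h) within range (\<lambda>t::real. u + t *\<^sub>R h))"
    using has_derivative_subset[OF assms(1) sub] by simp
  then have "((\<lambda>t. J (u + t *\<^sub>R h)) has_derivative (\<lambda>t. J' (t *\<^sub>R h))) (at 0)"
    by (rule has_derivative_in_compose[OF lin])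
  moreover have "(\<lambda>t. J' (t *\<^sub>R h)) = (*) (J' h)"
    using linear_scale[OF has_derivative_linear[OF assms(1)]] by (auto simp: mult.commute)
  ultimately show ?thesis by (simp add: has_field_derivative_def)
qed

text \<open>
  On the segment from \<open>u\<close> to \<open>v\<close>, convexity makes the chord minus the function minimal at the
  starting point; the one-sided test then compares the slope of the chord with the derivative.
\<close>

lemma convex_imp_above_tangent:
  fixes J :: "'v::real_normed_vector \<Rightarrow> real"
  assumes "(J has_derivative J') (at u within V)" "subspace V" "u \<in> V" "v \<in> V"
    and "convex_on V J"
  shows "J u + J' (v - u) \<le> J v"
proof -
  let ?k = "\<lambda>t. t * (J v - J u) - J (u + t *\<^sub>R (v - u))"
  have "v - u \<in> V" using assms by (simp add: subspace_diff)
  from directional_derivative[OF assms(1-3) this]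
  have "(?k has_real_derivative (J v - J u) - J' (v - u)) (at 0)"
    by (auto intro!: derivative_eq_intros)
  then have "0 \<le> (J v - J u) - J' (v - u)"
  proof (rule right_minimum_derivative_nonneg)
    fix t :: real assume t: "0 \<le> t" "t \<le> 1"
    have "J ((1 - t) *\<^sub>R u + t *\<^sub>R v) \<le> (1 - t) * J u + t * J v"
      by (rule convex_onD[OF assms(5)]) (use t assms in auto)
    also have "(1 - t) *\<^sub>R u + t *\<^sub>R v = u + t *\<^sub>R (v - u)"
      by (simp add: algebra_simps)
    finally show "?k 0 \<le> ?k t" by (simp add: algebra_simps)
  qed
  then show ?thesis by simp
qed

text \<open>
  Stampacchia's theorem for symmetric forms. The solution is the minimizer of
  \<open>E v = a v v / 2 - l v\<close> over \<open>C\<close>: by the parallelogram identity and coercivity every minimizing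
  sequence is Cauchy, and the inequality is the first order condition at its limit. Coercivity is asked
  only for differences of points of \<open>C\<close>. This lets the theorem serve twice: with the inner product it
  gives the projection onto \<open>C\<close>, and with a form that is degenerate on the ambient space but coercive on
  the subspace \<open>C\<close> it gives existence of weak solutions.
\<close>

theorem coercive_variational_inequality:
  fixes a :: "'v::real_inner \<Rightarrow> 'v \<Rightarrow> real" and l :: "'v \<Rightarrow> real"
  assumes a: "bounded_bilinear a" and sym: "\<And>x y. a x y = a y x"
    and l: "bounded_linear l"
    and C: "complete C" "convex C" "C \<noteq> {}"
    and c: "c > 0" and coercive: "\<And>x y. x \<in> C \<Longrightarrow> y \<in> C \<Longrightarrow> c * (norm (x - y))\<^sup>2 \<le> a (x - y) (x - y)"
  obtains u where "u \<in> C" "\<And>v. v \<in> C \<Longrightarrow> l (v - u) \<le> a u (v - u)"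
proof -
  interpret a: bounded_bilinear a by (rule a)
  interpret l: bounded_linear l by (rule l)
  define E where "E v = a v v / 2 - l v" for v
  have expand: "E (x + h) = E x + (a x h - l h) + a h h / 2" for x h
    by (simp add: E_def a.add_left a.add_right l.add sym[of h x] field_simps)
  have parallelogram: "E u + E v - 2 * E ((1/2) *\<^sub>R (u + v)) = a (u - v) (u - v) / 4" for u v
    by (simp add: E_def a.add_left a.add_right a.diff_left a.diff_right a.scaleR_left a.scaleR_right
        l.add l.scaleR sym[of v u] field_simps)
  obtain x0 where x0: "x0 \<in> C" using C by blast
  have bl: "bounded_linear (\<lambda>h. a x0 h - l h)"
    by (intro bounded_linear_sub a.bounded_linear_right l)
  obtain K where K: "\<And>h. norm (a x0 h - l h) \<le> norm h * K"
    using bounded_linear.bounded[OF bl] by blast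
  have below: "E x0 - K\<^sup>2 / (2 * c) \<le> E v" if "v \<in> C" for v
  proof -
    let ?n = "norm (v - x0)"
    have "E v = E x0 + (a x0 (v - x0) - l (v - x0)) + a (v - x0) (v - x0) / 2"
      using expand[of x0 "v - x0"] by simp
    moreover have "- (?n * K) \<le> a x0 (v - x0) - l (v - x0)"
      using K[of "v - x0"] by (simp add: abs_le_iff)
    moreover have "c * ?n\<^sup>2 \<le> a (v - x0) (v - x0)" using coercive[OF that x0] .
    moreover have "- (K\<^sup>2 / (2 * c)) \<le> - (?n * K) + c * ?n\<^sup>2 / 2"
    proof -
      \<comment> \<open>Completing the square absorbs the linear term into the coercive one.\<close>
      have "0 \<le> (c * ?n - K)\<^sup>2 / (2 * c)" using c by simp
      also have "\<dots> = - (?n * K) + c * ?n\<^sup>2 / 2 + K\<^sup>2 / (2 * c)"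
        using c by (simp add: field_simps power2_eq_square)
      finally show ?thesis by simp
    qed
    ultimately show ?thesis by linarith
  qed
  define m where "m = Inf (E ` C)"
  have bdd: "bdd_below (E ` C)" using below by (auto simp: bdd_below_def)
  have m_le: "m \<le> E v" if "v \<in> C" for v
    unfolding m_def using bdd that by (auto intro: cInf_lower)
  have "\<exists>v\<in>C. E v < m + 1 / Suc n" for n
  proof -
    have "Inf (E ` C) < m + 1 / Suc n" by (simp add: m_def)
    then obtain y where "y \<in> E ` C" "y < m + 1 / Suc n"
      using C(3) by (meson cInf_lessD image_is_empty)
    then show ?thesis by auto
  qed
  then obtain X where X: "\<And>n. X n \<in> C" "\<And>n. E (X n) < m + 1 / Suc n" by metis
  have close: "c / 4 * (norm (X i - X j))\<^sup>2 \<le> 1 / Suc i + 1 / Suc j" for i j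
  proof -
    have "(1/2) *\<^sub>R X i + (1/2) *\<^sub>R X j \<in> C"
      using C(2) X(1)[of i] X(1)[of j] by (intro convexD) auto
    then have "m \<le> E ((1/2) *\<^sub>R (X i + X j))" by (intro m_le) (simp add: scaleR_add_right)
    then show ?thesis
      using parallelogram[of "X i" "X j"] X(2)[of i] X(2)[of j] coercive[OF X(1)[of i] X(1)[of j]]
      by linarith
  qed
  have "Cauchy X"
  proof (rule metric_CauchyI)
    fix e :: real assume e: "0 < e"
    then have "0 < c / 4 * e\<^sup>2 / 2" using c by simp
    then obtain M where M: "1 / Suc M < c / 4 * e\<^sup>2 / 2"
      using nat_approx_posE by metis
    have "dist (X i) (X j) < e" if "M \<le> i" "M \<le> j" for i j
    proof -
      have "1 / Suc i \<le> 1 / Suc M" "1 / Suc j \<le> 1 / Suc M"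
        using that by (auto simp: frac_le)
      then have "c / 4 * (norm (X i - X j))\<^sup>2 < c / 4 * e\<^sup>2"
        using close[of i j] M by linarith
      then have "(norm (X i - X j))\<^sup>2 < e\<^sup>2" using c by simp
      then show ?thesis using e by (simp add: dist_norm power2_less_imp_less)
    qed
    then show "\<exists>M. \<forall>i\<ge>M. \<forall>j\<ge>M. dist (X i) (X j) < e" by blast
  qed
  then obtain u where u: "u \<in> C" "X \<longlonglongrightarrow> u"
    using C(1) X(1) unfolding complete_def by blast
  have "(\<lambda>n. E (X n)) \<longlonglongrightarrow> E u"
    unfolding E_def by (intro tendsto_intros a.tendsto l.tendsto u) simp
  moreover have "(\<lambda>n. E (X n)) \<longlonglongrightarrow> m"
  proof (rule tendsto_sandwich)
    show "(\<lambda>n. m) \<longlonglongrightarrow> m" by simp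
    show "(\<lambda>n. m + 1 / Suc n) \<longlonglongrightarrow> m"
      using tendsto_add[OF tendsto_const LIMSEQ_inverse_real_of_nat, of m] by (simp add: field_simps)
  qed (use m_le X in \<open>auto intro!: always_eventually less_imp_le\<close>)
  ultimately have Eu: "E u = m" by (rule LIMSEQ_unique)
  have "l (v - u) \<le> a u (v - u)" if v: "v \<in> C" for v
  proof -
    let ?h = "v - u"
    let ?f = "\<lambda>t. E u + t * (a u ?h - l ?h) + t * t * (a ?h ?h / 2)"
    have "(?f has_real_derivative (a u ?h - l ?h)) (at 0)"
      by (auto intro!: derivative_eq_intros)
    then have "0 \<le> a u ?h - l ?h"
    proof (rule right_minimum_derivative_nonneg)
      fix t :: real assume t: "0 \<le> t" "t \<le> 1"
      have "(1 - t) *\<^sub>R u + t *\<^sub>R v \<in> C"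
        using C(2) u v t by (intro convexD) auto
      moreover have "(1 - t) *\<^sub>R u + t *\<^sub>R v = u + t *\<^sub>R ?h" by (simp add: algebra_simps)
      ultimately have "m \<le> E (u + t *\<^sub>R ?h)" using m_le by simp
      also have "\<dots> = ?f t"
        unfolding expand a.scaleR_left a.scaleR_right l.scaleR
        by (simp add: right_diff_distrib)
      finally show "?f 0 \<le> ?f t" using Eu by simp
    qed
    then show ?thesis by simp
  qed
  with u(1) show thesis by (rule that)
qed

text \<open>
  \<open>projection\<close> is a choice among the nearest points, so for the implication from left to right a
  nearest point has to exist; Stampacchia's theorem provides one, as a solution of the inequality.
  Expanding \<open>dist q v\<close> around a solution shows that it is strictly nearer than every other point of \<open>C\<close>,
  hence the only value that the choice can take.
\<close>

lemma projection_iff_variational_inequality: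
  fixes C :: "'v::real_inner set"
  assumes "complete C" "convex C" "zb \<in> C"
  shows "zb = projection C q \<longleftrightarrow> (\<forall>z\<in>C. 0 \<le> (zb - q) \<bullet> (z - zb))"
proof -
  obtain u where u: "u \<in> C" "\<And>v. v \<in> C \<Longrightarrow> q \<bullet> (v - u) \<le> u \<bullet> (v - u)"
  proof (rule coercive_variational_inequality[of inner "inner q" C 1])
    show "bounded_linear (inner q)" by (rule bounded_linear_inner_right)
  qed (use assms in \<open>auto simp: bounded_bilinear_inner inner_commute power2_norm_eq_inner\<close>)
  have strict: "x \<in> C \<Longrightarrow> (\<forall>z\<in>C. 0 \<le> (x - q) \<bullet> (z - x)) \<Longrightarrow> v \<in> C \<Longrightarrow> v \<noteq> x \<Longrightarrow> dist q x < dist q v"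
    for x v
  proof -
    assume x: "x \<in> C" "\<forall>z\<in>C. 0 \<le> (x - q) \<bullet> (z - x)" and v: "v \<in> C" "v \<noteq> x"
    have "(dist q v)\<^sup>2 = (dist q x)\<^sup>2 + 2 * ((x - q) \<bullet> (v - x)) + (norm (v - x))\<^sup>2"
      unfolding dist_norm power2_norm_eq_inner by (simp add: inner_simps inner_commute algebra_simps)
    moreover have "0 < (norm (v - x))\<^sup>2" using v by simp
    ultimately have "(dist q x)\<^sup>2 < (dist q v)\<^sup>2" using x v by (smt (verit))
    then show ?thesis by (rule power2_less_imp_less) simp
  qed
  have VI_imp: "projection C q = x" if "x \<in> C" "\<forall>z\<in>C. 0 \<le> (x - q) \<bullet> (z - x)" for x
    unfolding projection_def arg_min_on_def arg_min_def is_arg_min_def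
    by (rule some_equality) (use strict[OF that] that in \<open>force+\<close>)
  have "\<forall>z\<in>C. 0 \<le> (u - q) \<bullet> (z - u)" using u by (auto simp: inner_diff_left)
  then show ?thesis using VI_imp u assms(3) by metis
qed

section \<open>Completeness of the space of square-integrable functions\<close>

lemma square_integrable_rep_L2: "square_integrable (rep_L2 u)"
  using Quotient3_rep_reflp[OF Quotient3_L2] by (auto simp: L2_rel_def)

lemma measurable_rep_L2 [measurable]: "rep_L2 u \<in> borel_measurable borel"
  using square_integrable_rep_L2[of u] by (simp add: square_integrable_def)

lemma AE_rep_abs_L2:
  assumes "square_integrable f"
  shows "AE x in lborel. rep_L2 (abs_L2 f) x = f x"
proof -
  have "L2_rel f f" using assms by (simp add: L2_rel_def)
  then have "L2_rel (rep_L2 (abs_L2 f)) f"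
    using Quotient3_rel[OF Quotient3_L2] Quotient3_abs_rep[OF Quotient3_L2]
      Quotient3_rep_reflp[OF Quotient3_L2] by metis
  then show ?thesis by (simp add: L2_rel_def)
qed

lemma L2_eq_iff: "u = v \<longleftrightarrow> (AE x in lborel. rep_L2 u x = rep_L2 v x)"
proof
  assume "AE x in lborel. rep_L2 u x = rep_L2 v x"
  then have "L2_rel (rep_L2 u) (rep_L2 v)" by (simp add: L2_rel_def square_integrable_rep_L2)
  then show "u = v"
    using Quotient3_rel[OF Quotient3_L2] Quotient3_abs_rep[OF Quotient3_L2] by metis
qed simp

lemma AE_rep_L2_add: "AE x in lborel. rep_L2 (u + v) x = rep_L2 u x + rep_L2 v x"
  using AE_rep_abs_L2[OF square_integrable_add[OF square_integrable_rep_L2 square_integrable_rep_L2]]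
  by (simp add: plus_L2_def)

lemma AE_rep_L2_diff: "AE x in lborel. rep_L2 (u - v) x = rep_L2 u x - rep_L2 v x"
  using AE_rep_abs_L2[OF square_integrable_diff[OF square_integrable_rep_L2 square_integrable_rep_L2]]
  by (simp add: minus_L2_def)

lemma AE_rep_L2_scaleR: "AE x in lborel. rep_L2 (c *\<^sub>R u) x = c * rep_L2 u x"
  using AE_rep_abs_L2[OF square_integrable_scale[OF square_integrable_rep_L2]]
  by (simp add: scaleR_L2_def)

lemma AE_rep_L2_zero: "AE x in lborel. rep_L2 0 x = 0"
  using AE_rep_abs_L2[OF square_integrable_zero] by (simp add: zero_L2_def)

lemma norm_L2_diff_sq: "(norm (u - v))\<^sup>2 = (LBINT x. (rep_L2 u x - rep_L2 v x)\<^sup>2)"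
  unfolding power2_norm_eq_inner inner_L2.rep_eq
proof (rule integral_cong_AE)
  show "AE x in lborel. rep_L2 (u - v) x * rep_L2 (u - v) x = (rep_L2 u x - rep_L2 v x)\<^sup>2"
    using AE_rep_L2_diff[of u v] by eventually_elim (simp add: power2_eq_square)
qed measurable

lemma L2_tendsto_AE_subseq:
  assumes "X \<longlonglongrightarrow> (u :: 'a::euclidean_space L2)"
  obtains r where "strict_mono r" "AE x in lborel. (\<lambda>n. rep_L2 (X (r n)) x) \<longlonglongrightarrow> rep_L2 u x"
proof -
  have "(\<lambda>n. (norm (X n - u))\<^sup>2) \<longlonglongrightarrow> 0\<^sup>2"
    using assms by (intro tendsto_power) (simp add: tendsto_norm_zero LIM_zero)
  then have "(\<lambda>n. LBINT x. norm ((rep_L2 (X n) x - rep_L2 u x)\<^sup>2)) \<longlonglongrightarrow> 0"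
    by (simp add: norm_L2_diff_sq)
  moreover have "integrable lborel (\<lambda>x. (rep_L2 (X n) x - rep_L2 u x)\<^sup>2)" for n
    using square_integrable_diff[OF square_integrable_rep_L2 square_integrable_rep_L2]
    by (simp add: square_integrable_def)
  ultimately obtain r where r: "strict_mono r"
    "AE x in lborel. (\<lambda>n. (rep_L2 (X (r n)) x - rep_L2 u x)\<^sup>2) \<longlonglongrightarrow> 0"
    using tendsto_L1_AE_subseq[of lborel "\<lambda>n x. (rep_L2 (X n) x - rep_L2 u x)\<^sup>2"] by blast
  from r(2) have "AE x in lborel. (\<lambda>n. rep_L2 (X (r n)) x) \<longlonglongrightarrow> rep_L2 u x"
  proof eventually_elim
    case (elim x)
    from tendsto_real_sqrt[OF elim] have "(\<lambda>n. rep_L2 (X (r n)) x - rep_L2 u x) \<longlonglongrightarrow> 0"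
      by (simp add: tendsto_rabs_zero_iff)
    then show ?case by (simp add: LIM_zero_iff)
  qed
  with r(1) show thesis by (rule that)
qed

text \<open>
  By the Cauchy--Schwarz inequality, multiplying by a fixed strictly positive square-integrable weight
  turns a Cauchy sequence in $L^2$ into one in $L^1$, where an almost everywhere convergent subsequence is
  available; positivity of the weight allows dividing it out again.
\<close>

lemma L2_Cauchy_AE_convergent_subseq:
  fixes X :: "nat \<Rightarrow> 'a::euclidean_space L2"
  assumes "Cauchy X"
  obtains r where "strict_mono r" "AE x in lborel. convergent (\<lambda>n. rep_L2 (X (r n)) x)"
proof -
  obtain w0 :: "'a \<Rightarrow> real" where w0: "w0 \<in> borel_measurable lborel" "\<And>x. w0 x > 0" "integrable lborel w0"
    using sigma_finite_measure.obtain_positive_integrable_function[OF sigma_finite_lborel] by metis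
  define w where "w x = sqrt (w0 x)" for x
  have w_pos: "w x > 0" for x using w0(2) by (simp add: w_def)
  have w: "square_integrable w"
    using w0 by (simp add: square_integrable_def w_def[abs_def] less_imp_le)
  define W where "W = abs_L2 w"
  have W: "AE x in lborel. rep_L2 W x = w x" unfolding W_def using w by (rule AE_rep_abs_L2)
  have int: "(LBINT x. norm (rep_L2 u x * w x - rep_L2 v x * w x)) \<le> norm (u - v) * norm W" for u v :: "'a L2"
  proof -
    let ?d = "\<lambda>x. \<bar>rep_L2 (u - v) x\<bar>"
    have d: "square_integrable ?d"
      using square_integrable_rep_L2[of "u - v"] by (simp add: square_integrable_def)
    have nd: "norm (abs_L2 ?d) = norm (u - v)"
    proof -
      have "(norm (abs_L2 ?d))\<^sup>2 = (norm (u - v))\<^sup>2"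
        unfolding power2_norm_eq_inner inner_L2.rep_eq
        by (intro integral_cong_AE) (use AE_rep_abs_L2[OF d] in auto)
      then show ?thesis by simp
    qed
    have "(LBINT x. norm (rep_L2 u x * w x - rep_L2 v x * w x)) = abs_L2 ?d \<bullet> W"
      unfolding inner_L2.rep_eq
    proof (rule integral_cong_AE)
      show "AE x in lborel. norm (rep_L2 u x * w x - rep_L2 v x * w x) = rep_L2 (abs_L2 ?d) x * rep_L2 W x"
        using AE_rep_abs_L2[OF d] AE_rep_L2_diff[of u v] W
      proof eventually_elim
        case (elim x)
        then show ?case
          using w_pos[of x] by (simp add: abs_mult less_imp_le flip: left_diff_distrib)
      qed
    qed (use w in \<open>auto simp: square_integrable_def\<close>)
    then show ?thesis using norm_cauchy_schwarz[of "abs_L2 ?d" W] nd by simp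
  qed
  have int_mult: "integrable lborel (\<lambda>x. rep_L2 (X n) x * w x)" for n
    by (rule square_integrable_mult[OF square_integrable_rep_L2 w])
  have "\<exists>N. \<forall>i\<ge>N. \<forall>j\<ge>N. (LBINT x. norm (rep_L2 (X i) x * w x - rep_L2 (X j) x * w x)) < e" if "e > 0" for e
  proof -
    have "0 < e / (norm W + 1)" using that by (simp add: add_nonneg_pos)
    then obtain N where N: "\<And>i j. i \<ge> N \<Longrightarrow> j \<ge> N \<Longrightarrow> dist (X i) (X j) < e / (norm W + 1)"
      using assms unfolding Cauchy_def by metis
    have "(LBINT x. norm (rep_L2 (X i) x * w x - rep_L2 (X j) x * w x)) < e" if "i \<ge> N" "j \<ge> N" for i j
    proof -
      have "norm (X i - X j) * norm W \<le> norm (X i - X j) * (norm W + 1)"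
        by (intro mult_left_mono) auto
      also have "\<dots> < e"
        using N[OF that] by (simp add: dist_norm pos_less_divide_eq add_nonneg_pos)
      finally show ?thesis using int[of "X i" "X j"] by linarith
    qed
    then show ?thesis by blast
  qed
  then obtain r where r: "strict_mono r" "AE x in lborel. Cauchy (\<lambda>n. rep_L2 (X (r n)) x * w x)"
    using cauchy_L1_AE_cauchy_subseq[of lborel "\<lambda>n x. rep_L2 (X n) x * w x"] int_mult by blast
  from r(2) have "AE x in lborel. convergent (\<lambda>n. rep_L2 (X (r n)) x)"
  proof eventually_elim
    case (elim x)
    then have "convergent (\<lambda>n. rep_L2 (X (r n)) x * w x)" by (simp add: Cauchy_convergent_iff)
    then show ?case using w_pos[of x] by (simp add: convergent_mult_const_right_iff)
  qed
  with r(1) show thesis by (rule that)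
qed

text \<open>
  Riesz--Fischer: the almost everywhere limit of the subsequence is the limit in $L^2$, because Fatou's
  lemma transfers the Cauchy estimate from the subsequence to its pointwise limit.
\<close>

instance L2 :: (euclidean_space) complete_space
proof
  fix X :: "nat \<Rightarrow> 'a L2"
  assume X: "Cauchy X"
  obtain r where r: "strict_mono r" "AE x in lborel. convergent (\<lambda>n. rep_L2 (X (r n)) x)"
    using L2_Cauchy_AE_convergent_subseq[OF X] .
  define f where "f x = lim (\<lambda>n. rep_L2 (X (r n)) x)" for x
  have f_meas: "f \<in> borel_measurable lborel" unfolding f_def by measurable
  have f_lim: "AE x in lborel. (\<lambda>n. rep_L2 (X (r n)) x) \<longlonglongrightarrow> f x"
    using r(2) unfolding f_def by eventually_elim (simp add: convergent_LIMSEQ_iff)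
  have tail: "(\<integral>\<^sup>+x. ennreal ((f x - rep_L2 (X m) x)\<^sup>2) \<partial>lborel) \<le> ennreal (e\<^sup>2)"
    if e: "\<And>k. k \<ge> M \<Longrightarrow> dist (X k) (X m) \<le> e" for M m e
  proof -
    have "(\<integral>\<^sup>+x. ennreal ((f x - rep_L2 (X m) x)\<^sup>2) \<partial>lborel)
        = (\<integral>\<^sup>+x. liminf (\<lambda>n. ennreal ((rep_L2 (X (r n)) x - rep_L2 (X m) x)\<^sup>2)) \<partial>lborel)"
    proof (rule nn_integral_cong_AE, use f_lim in eventually_elim)
      case (elim x)
      then have "(\<lambda>n. ennreal ((rep_L2 (X (r n)) x - rep_L2 (X m) x)\<^sup>2)) \<longlonglongrightarrow> ennreal ((f x - rep_L2 (X m) x)\<^sup>2)"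
        by (intro tendsto_intros) auto
      then show ?case by (rule lim_imp_Liminf[OF sequentially_bot, symmetric])
    qed
    also have "\<dots> \<le> liminf (\<lambda>n. \<integral>\<^sup>+x. ennreal ((rep_L2 (X (r n)) x - rep_L2 (X m) x)\<^sup>2) \<partial>lborel)"
      by (rule nn_integral_liminf) measurable
    also have "\<dots> \<le> ennreal (e\<^sup>2)"
    proof (rule Liminf_le)
      have "(\<integral>\<^sup>+x. ennreal ((rep_L2 (X (r n)) x - rep_L2 (X m) x)\<^sup>2) \<partial>lborel) \<le> ennreal (e\<^sup>2)" if "n \<ge> M" for n
      proof -
        have "(\<integral>\<^sup>+x. ennreal ((rep_L2 (X (r n)) x - rep_L2 (X m) x)\<^sup>2) \<partial>lborel) = ennreal ((norm (X (r n) - X m))\<^sup>2)"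
          unfolding norm_L2_diff_sq
          using square_integrable_diff[OF square_integrable_rep_L2 square_integrable_rep_L2]
          by (intro nn_integral_eq_integral) (auto simp: square_integrable_def)
        moreover have "norm (X (r n) - X m) \<le> e"
          using e[of "r n"] seq_suble[OF r(1), of n] that by (simp add: dist_norm)
        ultimately show ?thesis by (simp add: power_mono ennreal_leI)
      qed
      then show "\<forall>\<^sub>F n in sequentially. (\<integral>\<^sup>+x. ennreal ((rep_L2 (X (r n)) x - rep_L2 (X m) x)\<^sup>2) \<partial>lborel) \<le> ennreal (e\<^sup>2)"
        by (auto simp: eventually_sequentially)
    qed simp
    finally show ?thesis .
  qed
  have diff_int: "square_integrable (\<lambda>x. f x - rep_L2 (X m) x)"
    if "\<And>k. k \<ge> M \<Longrightarrow> dist (X k) (X m) \<le> e" for M m e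
  proof -
    have "(\<integral>\<^sup>+x. ennreal ((f x - rep_L2 (X m) x)\<^sup>2) \<partial>lborel) \<le> ennreal (e\<^sup>2)"
      using that by (rule tail)
    then have "(\<integral>\<^sup>+x. ennreal ((f x - rep_L2 (X m) x)\<^sup>2) \<partial>lborel) < \<infinity>"
      by (simp add: le_less_trans)
    then show ?thesis
      using f_meas unfolding square_integrable_def by (auto intro!: integrableI_nonneg)
  qed
  obtain M1 where "\<And>k. k \<ge> M1 \<Longrightarrow> dist (X k) (X M1) \<le> 1"
    using X unfolding Cauchy_def by (metis less_imp_le order_refl zero_less_one)
  then have "square_integrable (\<lambda>x. f x - rep_L2 (X M1) x)" by (rule diff_int)
  from square_integrable_add[OF this square_integrable_rep_L2[of "X M1"]]
  have f: "square_integrable f" by simp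
  have "X \<longlonglongrightarrow> abs_L2 f"
  proof (rule metric_LIMSEQ_I)
    fix e :: real assume e: "0 < e"
    then have "0 < e / 2" by simp
    from metric_CauchyD[OF X this]
    obtain M where M: "\<And>m n. m \<ge> M \<Longrightarrow> n \<ge> M \<Longrightarrow> dist (X m) (X n) < e / 2" by blast
    have "dist (X m) (abs_L2 f) < e" if "m \<ge> M" for m
    proof -
      have le: "\<And>k. k \<ge> M \<Longrightarrow> dist (X k) (X m) \<le> e / 2" using M that by (simp add: less_imp_le)
      have "ennreal ((norm (abs_L2 f - X m))\<^sup>2) = ennreal (LBINT x. (f x - rep_L2 (X m) x)\<^sup>2)"
        unfolding norm_L2_diff_sq
        by (intro arg_cong[where f = ennreal] integral_cong_AE) (use AE_rep_abs_L2[OF f] f_meas in auto)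
      also have "\<dots> = (\<integral>\<^sup>+x. ennreal ((f x - rep_L2 (X m) x)\<^sup>2) \<partial>lborel)"
        using diff_int[OF le] by (intro nn_integral_eq_integral[symmetric]) (auto simp: square_integrable_def)
      also have "\<dots> \<le> ennreal ((e / 2)\<^sup>2)" by (rule tail[OF le])
      finally have "(norm (abs_L2 f - X m))\<^sup>2 \<le> (e / 2)\<^sup>2"
        by (rule ennreal_le_iff[OF zero_le_power2, THEN iffD1])
      then have "norm (abs_L2 f - X m) \<le> e / 2"
        by (rule power2_le_imp_le) (use e in simp)
      then show ?thesis using e by (simp add: dist_norm norm_minus_commute)
    qed
    then show "\<exists>M. \<forall>m\<ge>M. dist (X m) (abs_L2 f) < e" by blast
  qed
  then show "convergent X" by (auto simp: convergent_def)
qed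

lemma AE_rep_restrict_L2:
  assumes "A \<in> sets borel"
  shows "AE x in lborel. rep_L2 (restrict_L2 A u) x = indicator A x * rep_L2 u x"
  unfolding restrict_L2_def
proof (rule AE_rep_abs_L2)
  have "integrable lborel (\<lambda>x. indicator A x *\<^sub>R (rep_L2 u x)\<^sup>2)"
    using square_integrable_rep_L2[of u] assms
    by (intro integrable_mult_indicator) (auto simp: square_integrable_def)
  moreover have "(\<lambda>x. indicator A x *\<^sub>R (rep_L2 u x)\<^sup>2) = (\<lambda>x. (indicator A x * rep_L2 u x)\<^sup>2)"
    by (auto simp: indicator_def)
  ultimately show "square_integrable (\<lambda>x. indicator A x * rep_L2 u x)"
    using assms by (simp add: square_integrable_def)
qed

lemma restrict_L2_in_L2_on: "A \<in> sets borel \<Longrightarrow> restrict_L2 A u \<in> L2_on A"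
  unfolding L2_on_def using AE_rep_restrict_L2[of A u] by (auto elim!: eventually_mono)

lemma subspace_L2_on: "subspace (L2_on A)"
proof (rule subspaceI)
  show "0 \<in> L2_on A" using AE_rep_L2_zero by (auto simp: L2_on_def)
next
  fix u v :: "'a L2" assume "u \<in> L2_on A" "v \<in> L2_on A"
  then have "AE x in lborel. x \<notin> A \<longrightarrow> rep_L2 u x = 0" "AE x in lborel. x \<notin> A \<longrightarrow> rep_L2 v x = 0"
    by (auto simp: L2_on_def)
  then have "AE x in lborel. x \<notin> A \<longrightarrow> rep_L2 (u + v) x = 0"
    using AE_rep_L2_add[of u v] by eventually_elim auto
  then show "u + v \<in> L2_on A" by (simp add: L2_on_def)
next
  fix c :: real and u :: "'a L2" assume "u \<in> L2_on A"
  then have "AE x in lborel. x \<notin> A \<longrightarrow> rep_L2 u x = 0" by (auto simp: L2_on_def)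
  then have "AE x in lborel. x \<notin> A \<longrightarrow> rep_L2 (c *\<^sub>R u) x = 0"
    using AE_rep_L2_scaleR[of c u] by eventually_elim auto
  then show "c *\<^sub>R u \<in> L2_on A" by (simp add: L2_on_def)
qed

lemma closed_L2_on: "closed (L2_on A)"
  unfolding closed_sequential_limits
proof (intro allI impI, elim conjE)
  fix X and u :: "'a L2" assume X: "\<forall>n. X n \<in> L2_on A" "X \<longlonglongrightarrow> u"
  obtain r where r: "strict_mono r" "AE x in lborel. (\<lambda>n. rep_L2 (X (r n)) x) \<longlonglongrightarrow> rep_L2 u x"
    using L2_tendsto_AE_subseq[OF X(2)] .
  have "\<forall>n. AE x in lborel. x \<notin> A \<longrightarrow> rep_L2 (X (r n)) x = 0"
    using X(1) by (simp add: L2_on_def)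
  then have "AE x in lborel. \<forall>n. x \<notin> A \<longrightarrow> rep_L2 (X (r n)) x = 0"
    by (rule AE_all_countable[THEN iffD2])
  with r(2) have "AE x in lborel. x \<notin> A \<longrightarrow> rep_L2 u x = 0"
    by eventually_elim (auto simp: LIMSEQ_const_iff)
  then show "u \<in> L2_on A" by (simp add: L2_on_def)
qed

section \<open>The converse of Hoelder's inequality\<close>

text \<open>
  With $T_n$ the partial sums of $a$, the quadratic weights telescope,
  $a_n / (1 + T_{n+1})^2 \le 1 / (1 + T_n) - 1 / (1 + T_{n+1})$. With the linear weights, the block of terms
  from $m$ to $n$ is at least $(T_n - T_m) / (1 + T_n)$, which tends to 1 when $T$ is unbounded, so the
  series cannot be Cauchy.
\<close>

lemma Abel_Dini:
  fixes a :: "nat \<Rightarrow> real"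
  assumes a: "\<And>n. 0 \<le> a n"
  defines "T \<equiv> \<lambda>n. \<Sum>k<n. a k"
  shows "summable (\<lambda>k. a k / (1 + T (Suc k))\<^sup>2)"
    and "summable (\<lambda>k. a k / (1 + T (Suc k))) \<Longrightarrow> summable a"
proof -
  have T0: "0 \<le> T n" for n by (simp add: T_def a sum_nonneg)
  have TSuc: "T (Suc n) = T n + a n" for n by (simp add: T_def)
  have mono: "T i \<le> T j" if "i \<le> j" for i j
    unfolding T_def by (rule sum_mono2) (use that a in auto)
  have "(\<Sum>k<n. a k / (1 + T (Suc k))\<^sup>2) \<le> 1 - 1 / (1 + T n)" for n
  proof (induction n)
    case 0
    then show ?case by (simp add: T_def)
  next
    case (Suc n)
    let ?s = "1 + T n" and ?t = "1 + T (Suc n)"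
    have st: "0 < ?s" "?s \<le> ?t" "0 < ?t" using T0[of n] T0[of "Suc n"] mono[of n "Suc n"] by auto
    have "a n / ?t\<^sup>2 \<le> a n / (?s * ?t)"
      unfolding power2_eq_square using st a[of n] by (intro divide_left_mono mult_right_mono) auto
    also have "\<dots> = 1 / ?s - 1 / ?t" using st by (simp add: field_simps TSuc)
    finally show ?case using Suc by simp
  qed
  also have "1 - 1 / (1 + T n) \<le> 1" for n using T0[of n] by simp
  finally show "summable (\<lambda>k. a k / (1 + T (Suc k))\<^sup>2)"
    by (intro summableI_nonneg_bounded[where x = 1]) (simp_all add: a)
  show "summable a" if s: "summable (\<lambda>k. a k / (1 + T (Suc k)))"
  proof -
    have "\<exists>N. \<forall>m\<ge>N. \<forall>n. norm (\<Sum>k=m..<n. a k / (1 + T (Suc k))) < 1 / 2"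
      by (rule summable_Cauchy[THEN iffD1, OF s, rule_format]) simp
    then obtain m where m: "\<forall>i\<ge>m. \<forall>n. norm (\<Sum>k=i..<n. a k / (1 + T (Suc k))) < 1 / 2" ..
    have "T n \<le> 1 + 2 * T m" for n
    proof (cases "m \<le> n")
      case True
      have "T m + (\<Sum>k=m..<n. a k) = T n"
        unfolding T_def lessThan_atLeast0 using True by (intro sum.atLeastLessThan_concat) auto
      then have "(T n - T m) / (1 + T n) = (\<Sum>k=m..<n. a k / (1 + T n))"
        unfolding sum_divide_distrib[symmetric] by (simp add: diff_eq_eq)
      also have "\<dots> \<le> (\<Sum>k=m..<n. a k / (1 + T (Suc k)))"
        using T0 a by (intro sum_mono divide_left_mono) (auto intro!: mono mult_pos_pos add_pos_nonneg)
      also have "\<dots> < 1 / 2" using m[rule_format, OF order_refl, of n] by simp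
      finally show ?thesis using T0[of n] by (simp add: field_simps)
    next
      case False
      then show ?thesis using mono[of n m] T0[of m] by simp
    qed
    then show ?thesis
      by (intro summableI_nonneg_bounded[of a "1 + 2 * T m"]) (simp_all add: a T_def)
  qed
qed

text \<open>
  The space is cut into countably many levels on which \<open>g\<close> and its argument are bounded. Dividing \<open>g\<close> on
  each level by one plus the mass of \<open>g\<^sup>2\<close> up to that level gives, by the first half of
  \<open>Abel_Dini\<close>, a square-integrable test function. Its product with \<open>g\<close> is integrable by assumption, and the
  second half then says that the masses of the levels are summable.
\<close>

lemma square_integrable_if_products_integrable:
  fixes g :: "'a::euclidean_space \<Rightarrow> real"
  assumes g [measurable]: "g \<in> borel_measurable lborel"
    and prod: "\<And>f. square_integrable f \<Longrightarrow> integrable lborel (\<lambda>x. f x * g x)"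
  shows "square_integrable g"
proof -
  \<comment> \<open>Bounding the argument as well makes every level have finite measure.\<close>
  define level where "level x = nat \<lceil>max \<bar>g x\<bar> (norm x)\<rceil>" for x
  have level [measurable]: "level \<in> measurable lborel (count_space UNIV)"
    unfolding level_def by measurable
  define A where "A k = {x. level x = k}" for k
  have A [measurable]: "A k \<in> sets borel" for k
  proof -
    have "{x \<in> space lborel. level x = k} \<in> sets lborel" by measurable
    then show ?thesis by (simp add: A_def)
  qed
  have A_bounds: "\<bar>g x\<bar> \<le> k" "norm x \<le> k" if "x \<in> A k" for x k
    using that unfolding A_def level_def by (auto; linarith)+
  define a where "a k = (LBINT x. indicator (A k) x * (g x)\<^sup>2)" for k
  have int: "integrable lborel (\<lambda>x. indicator (A k) x * (g x)\<^sup>2)" for k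
  proof (rule Bochner_Integration.integrable_bound)
    show "integrable lborel (\<lambda>x::'a. (real k)\<^sup>2 * indicator (cball 0 (real k)) x)"
      using emeasure_bounded_finite[OF bounded_cball, of "0::'a" "real k"]
      by (intro integrable_mult_right integrable_real_indicator) auto
    show "AE x in lborel. norm (indicator (A k) x * (g x)\<^sup>2) \<le> norm ((real k)\<^sup>2 * indicator (cball 0 (real k)) x)"
    proof (rule AE_I2)
      fix x
      show "norm (indicator (A k) x * (g x)\<^sup>2) \<le> norm ((real k)\<^sup>2 * indicator (cball 0 (real k)) x)"
        using A_bounds[of x k] abs_le_square_iff[of "g x" "real k"] by (auto simp: indicator_def)
    qed
  qed measurable
  have a0: "0 \<le> a k" for k unfolding a_def by (intro integral_nonneg_AE) auto
  have slices: "(\<integral>\<^sup>+x. ennreal (c (level x) * (g x)\<^sup>2) \<partial>lborel) = (\<Sum>k. ennreal (c k * a k))"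
    if c: "\<And>k. 0 \<le> c k" for c :: "nat \<Rightarrow> real"
  proof -
    have "ennreal (c (level x) * (g x)\<^sup>2) = (\<Sum>k. ennreal (c k * (indicator (A k) x * (g x)\<^sup>2)))" for x
      by (subst suminf_finite[of "{level x}"]) (auto simp: A_def)
    then have "(\<integral>\<^sup>+x. ennreal (c (level x) * (g x)\<^sup>2) \<partial>lborel)
        = (\<Sum>k. \<integral>\<^sup>+x. ennreal (c k * (indicator (A k) x * (g x)\<^sup>2)) \<partial>lborel)"
      by (simp add: nn_integral_suminf)
    also have "\<dots> = (\<Sum>k. ennreal (c k * a k))"
    proof (rule suminf_cong)
      fix k
      have "(\<integral>\<^sup>+x. ennreal (c k * (indicator (A k) x * (g x)\<^sup>2)) \<partial>lborel)
          = ennreal (LBINT x. c k * (indicator (A k) x * (g x)\<^sup>2))"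
        by (rule nn_integral_eq_integral) (use int c in auto)
      then show "(\<integral>\<^sup>+x. ennreal (c k * (indicator (A k) x * (g x)\<^sup>2)) \<partial>lborel) = ennreal (c k * a k)"
        by (simp add: a_def)
    qed
    finally show ?thesis .
  qed
  have summable_iff: "integrable lborel (\<lambda>x. c (level x) * (g x)\<^sup>2) \<longleftrightarrow> summable (\<lambda>k. c k * a k)"
    if c: "\<And>k. 0 \<le> c k" for c :: "nat \<Rightarrow> real"
  proof -
    have "integrable lborel (\<lambda>x. c (level x) * (g x)\<^sup>2)
        \<longleftrightarrow> (\<integral>\<^sup>+x. ennreal (c (level x) * (g x)\<^sup>2) \<partial>lborel) < \<infinity>"
      using c by (subst integrable_iff_bounded) simp
    also have "\<dots> \<longleftrightarrow> summable (\<lambda>k. c k * a k)"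
      unfolding slices[of c, OF c]
    proof
      assume "(\<Sum>k. ennreal (c k * a k)) < \<infinity>"
      then show "summable (\<lambda>k. c k * a k)"
        using c a0 by (intro summable_suminf_not_top) auto
    next
      assume "summable (\<lambda>k. c k * a k)"
      then have "(\<Sum>k. ennreal (c k * a k)) \<noteq> top"
        by (rule ennreal_suminf_neq_top) (simp add: c a0)
      then show "(\<Sum>k. ennreal (c k * a k)) < \<infinity>" by (simp add: less_top[symmetric])
    qed
    finally show ?thesis .
  qed
  define T where "T n = (\<Sum>k<n. a k)" for n
  have T0: "0 \<le> T n" for n by (simp add: T_def a0 sum_nonneg)
  let ?f = "\<lambda>x. g x / (1 + T (Suc (level x)))"
  have "integrable lborel (\<lambda>x. 1 / (1 + T (Suc (level x)))\<^sup>2 * (g x)\<^sup>2)"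
    using summable_iff[of "\<lambda>k. 1 / (1 + T (Suc k))\<^sup>2"] Abel_Dini(1)[of a] a0 by (simp add: T_def)
  then have "square_integrable ?f"
    by (simp add: square_integrable_def power_divide)
  then have "integrable lborel (\<lambda>x. ?f x * g x)" by (rule prod)
  then have "integrable lborel (\<lambda>x. 1 / (1 + T (Suc (level x))) * (g x)\<^sup>2)"
    by (simp add: power2_eq_square)
  then have "summable (\<lambda>k. a k / (1 + T (Suc k)))"
    using summable_iff[of "\<lambda>k. 1 / (1 + T (Suc k))"] T0 by simp
  then have "summable a" using Abel_Dini(2)[of a] a0 by (simp add: T_def)
  then show ?thesis using summable_iff[of "\<lambda>_. 1"] by (simp add: square_integrable_def)
qed

section \<open>The energy space of the fractional Laplacian\<close>

lemma AE_lborel_fst: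
  assumes "AE x in lborel. P x"
  shows "AE p in (lborel :: ('a::euclidean_space \<times> 'b::euclidean_space) measure). P (fst p)"
proof -
  obtain N where N: "\<And>x. x \<in> space lborel - N \<Longrightarrow> P x" "N \<in> null_sets lborel"
    using AE_E3[OF assms] by blast
  have "N \<times> UNIV \<in> null_sets (lborel \<Otimes>\<^sub>M (lborel :: 'b measure))"
    by (rule lborel.times_in_null_sets1[OF N(2)]) simp
  then show ?thesis
    using N(1) by (intro AE_I'[of "N \<times> UNIV"]) (fastforce simp: lborel_prod)+
qed

lemma AE_lborel_snd:
  assumes "AE x in lborel. P x"
  shows "AE p in (lborel :: ('b::euclidean_space \<times> 'a::euclidean_space) measure). P (snd p)"
proof -
  obtain N where N: "\<And>x. x \<in> space lborel - N \<Longrightarrow> P x" "N \<in> null_sets lborel"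
    using AE_E3[OF assms] by blast
  have "UNIV \<times> N \<in> null_sets ((lborel :: 'b measure) \<Otimes>\<^sub>M lborel)"
    by (rule lborel.times_in_null_sets2[OF _ N(2)]) simp
  then show ?thesis
    using N(1) by (intro AE_I'[of "UNIV \<times> N"]) (fastforce simp: lborel_prod)+
qed

text \<open>
  The kernel is split evenly between the two factors of the bilinear form. The fractional energy thus
  becomes the inner product of $L^2$ on the product space, and its completeness can be used.
\<close>

definition diff_quotient :: "real \<Rightarrow> 'a::euclidean_space L2 \<Rightarrow> 'a \<times> 'a \<Rightarrow> real" where
  "diff_quotient s u = (\<lambda>(x, y).
     (rep_L2 u x - rep_L2 u y) / norm (x - y) powr ((real DIM('a) + 2 * s) / 2))"

definition diff_quotient_L2 :: "real \<Rightarrow> 'a::euclidean_space L2 \<Rightarrow> ('a \<times> 'a) L2" where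
  "diff_quotient_L2 s u = abs_L2 (diff_quotient s u)"

lemma measurable_diff_quotient [measurable]: "diff_quotient s u \<in> borel_measurable borel"
  unfolding diff_quotient_def borel_prod[symmetric] by measurable

lemma diff_quotient_mult:
  "diff_quotient s u p * diff_quotient s v p =
    (case p of (x, y) \<Rightarrow> (rep_L2 u x - rep_L2 u y) * (rep_L2 v x - rep_L2 v y)
      / norm (x - y) powr (real DIM('a) + 2 * s))" for u v :: "'a::euclidean_space L2"
  by (cases p) (simp add: diff_quotient_def powr_add[symmetric])

lemma W_s2_iff: "u \<in> W_s2 s \<longleftrightarrow> square_integrable (diff_quotient s u)"
  using diff_quotient_mult[of s u _ u]
  by (simp add: W_s2_def square_integrable_def power2_eq_square lborel_prod)

lemma W0_s2_eq: "W0_s2 s \<Omega> = W_s2 s \<inter> L2_on \<Omega>"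
  by (auto simp: W0_s2_def L2_on_def)

lemma frac_form_eq_inner:
  fixes u v :: "'a::euclidean_space L2"
  assumes "u \<in> W_s2 s" "v \<in> W_s2 s"
  shows "frac_form s u v = frac_const DIM('a) s / 2 * (diff_quotient_L2 s u \<bullet> diff_quotient_L2 s v)"
  using assms unfolding diff_quotient_L2_def W_s2_iff
  by (simp add: inner_L2.abs_eq L2_rel_def frac_form_def diff_quotient_mult lborel_prod)

lemma diff_quotient_comb:
  fixes u v :: "'a::euclidean_space L2"
  assumes u: "u \<in> W_s2 s" and v: "v \<in> W_s2 s"
  shows "u + c *\<^sub>R v \<in> W_s2 s"
    and "diff_quotient_L2 s (u + c *\<^sub>R v) = diff_quotient_L2 s u + c *\<^sub>R diff_quotient_L2 s v"
proof -
  have "AE x in lborel. rep_L2 (u + c *\<^sub>R v) x = rep_L2 u x + c * rep_L2 v x"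
    using AE_rep_L2_add[of u "c *\<^sub>R v"] AE_rep_L2_scaleR[of c v] by eventually_elim simp
  from AE_lborel_fst[OF this, where 'b = 'a] AE_lborel_snd[OF this, where 'b = 'a]
  have ae: "AE p in lborel. diff_quotient s (u + c *\<^sub>R v) p = diff_quotient s u p + c * diff_quotient s v p"
    by eventually_elim (simp add: diff_quotient_def split_beta algebra_simps add_divide_distrib diff_divide_distrib)
  have u': "square_integrable (diff_quotient s u)" and v': "square_integrable (diff_quotient s v)"
    using u v by (simp_all add: W_s2_iff)
  have sq: "square_integrable (\<lambda>p. diff_quotient s u p + c * diff_quotient s v p)"
    by (intro square_integrable_add square_integrable_scale u' v')
  have "integrable lborel (\<lambda>p. (diff_quotient s (u + c *\<^sub>R v) p)\<^sup>2)
      \<longleftrightarrow> integrable lborel (\<lambda>p. (diff_quotient s u p + c * diff_quotient s v p)\<^sup>2)"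
    by (rule integrable_cong_AE) (use ae in auto)
  then have w': "square_integrable (diff_quotient s (u + c *\<^sub>R v))"
    using sq by (simp add: square_integrable_def)
  then show "u + c *\<^sub>R v \<in> W_s2 s" by (simp add: W_s2_iff)
  show "diff_quotient_L2 s (u + c *\<^sub>R v) = diff_quotient_L2 s u + c *\<^sub>R diff_quotient_L2 s v"
    unfolding L2_eq_iff diff_quotient_L2_def
    using ae AE_rep_abs_L2[OF w'] AE_rep_abs_L2[OF u'] AE_rep_abs_L2[OF v']
      AE_rep_L2_add[of "abs_L2 (diff_quotient s u)" "c *\<^sub>R abs_L2 (diff_quotient s v)"]
      AE_rep_L2_scaleR[of c "abs_L2 (diff_quotient s v)"]
    by eventually_elim simp
qed

lemma zero_in_W_s2: "0 \<in> W_s2 s"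
proof -
  have "AE p in lborel. (diff_quotient s 0 (p :: 'a \<times> 'a))\<^sup>2 = 0"
    using AE_lborel_fst[OF AE_rep_L2_zero, where 'b = 'a] AE_lborel_snd[OF AE_rep_L2_zero, where 'b = 'a]
    by eventually_elim (simp add: diff_quotient_def split_beta)
  then have "integrable lborel (\<lambda>p :: 'a \<times> 'a. (diff_quotient s 0 p)\<^sup>2) \<longleftrightarrow> integrable lborel (\<lambda>p :: 'a \<times> 'a. 0 :: real)"
    by (intro integrable_cong_AE) auto
  then show ?thesis by (simp add: W_s2_iff square_integrable_def)
qed

lemma W0_s2_comb: "u \<in> W0_s2 s \<Omega> \<Longrightarrow> v \<in> W0_s2 s \<Omega> \<Longrightarrow> u + c *\<^sub>R v \<in> W0_s2 s \<Omega>"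
  unfolding W0_s2_eq using diff_quotient_comb(1)
  by (auto intro: subspace_add subspace_scale subspace_L2_on)

text \<open>
  A ball disjoint from \<open>\<Omega>\<close> suffices: for \<open>x\<close> in \<open>\<Omega>\<close> and \<open>y\<close> in that ball, \<open>u y = 0\<close> and
  \<open>norm (x - y)\<close> is bounded, so this part of the energy already controls a multiple of \<open>(u x)\<^sup>2\<close>.
\<close>

lemma fractional_Poincare:
  fixes \<Omega> :: "'a::euclidean_space set"
  assumes "bounded \<Omega>" and "0 < s"
  obtains c where "c > 0"
    "\<And>u. u \<in> W0_s2 s \<Omega> \<Longrightarrow> c * (norm u)\<^sup>2 \<le> (norm (diff_quotient_L2 s u))\<^sup>2"
proof -
  obtain R where R: "R > 0" "\<And>x. x \<in> \<Omega> \<Longrightarrow> norm x \<le> R"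
    using assms(1) bounded_pos by blast
  obtain e :: 'a where e: "norm e = 1" using norm_Basis nonempty_Basis by blast
  \<comment> \<open>Every point of this ball has norm greater than \<open>R\<close>.\<close>
  define B where "B = ball ((R + 1) *\<^sub>R e) 1"
  define M where "M = 2 * R + 2"
  define q where "q = real DIM('a) + 2 * s"
  have q: "q > 0" using assms(2) by (simp add: q_def add_nonneg_pos)
  have B: "R < norm y" "norm y \<le> R + 2" if "y \<in> B" for y
  proof -
    have d: "norm ((R + 1) *\<^sub>R e - y) < 1" using that by (simp add: B_def dist_norm)
    have n: "norm ((R + 1) *\<^sub>R e) = R + 1" using R e by simp
    show "R < norm y" using d n norm_triangle_ineq2[of "(R + 1) *\<^sub>R e" y] by linarith
    show "norm y \<le> R + 2"
      using d n norm_triangle_ineq2[of y "(R + 1) *\<^sub>R e"] by (simp add: norm_minus_commute)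
  qed
  define \<beta> where "\<beta> = measure lborel B"
  have \<beta>: "\<beta> > 0" "emeasure lborel B = ennreal \<beta>"
    using emeasure_bounded_finite[of B]
    by (simp_all add: \<beta>_def B_def content_ball_pos emeasure_eq_ennreal_measure less_top)
  have [measurable]: "B \<in> sets borel" by (simp add: B_def)
  have M: "M powr q > 0" using R by (simp add: M_def)
  show thesis
  proof (rule that)
    show "\<beta> / M powr q > 0" using \<beta> M by simp
    fix u assume u: "u \<in> W0_s2 s \<Omega>"
    then have sq: "square_integrable (diff_quotient s u)" by (simp add: W0_s2_eq W_s2_iff)
    have outside: "AE x in lborel. x \<notin> \<Omega> \<longrightarrow> rep_L2 u x = 0" using u by (simp add: W0_s2_eq L2_on_def)
    let ?h = "\<lambda>p. ennreal ((rep_L2 u (fst p))\<^sup>2 / M powr q) * indicator B (snd p)"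
    have le: "AE p in lborel. ?h p \<le> ennreal ((diff_quotient s u p)\<^sup>2)"
      using AE_lborel_fst[OF outside, where 'b = 'a] AE_lborel_snd[OF outside, where 'b = 'a]
    proof eventually_elim
      case (elim p)
      obtain x y where p: "p = (x, y)" by (cases p)
      show ?case
      proof (cases "x \<in> \<Omega> \<and> y \<in> B")
        case True
        then have xy: "norm x \<le> R" "R < norm y" "norm y \<le> R + 2" using R B by auto
        then have "y \<notin> \<Omega>" using R by force
        then have "rep_L2 u y = 0" using elim p by simp
        then have eq: "(diff_quotient s u p)\<^sup>2 = (rep_L2 u x)\<^sup>2 / norm (x - y) powr q"
          using diff_quotient_mult[of s u p u] by (simp add: p q_def power2_eq_square)
        have "0 < norm (x - y)" using xy by auto
        moreover have "norm (x - y) \<le> M"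
          using norm_triangle_ineq4[of x y] xy by (simp add: M_def)
        ultimately have "(rep_L2 u x)\<^sup>2 / M powr q \<le> (diff_quotient s u p)\<^sup>2"
          unfolding eq using M q by (intro divide_left_mono powr_mono2) auto
        then show ?thesis using True by (simp add: p ennreal_leI)
      next
        case False
        then show ?thesis using elim by (auto simp: p indicator_def)
      qed
    qed
    have "ennreal (\<beta> / M powr q * (norm u)\<^sup>2) = ennreal ((norm u)\<^sup>2 / M powr q) * ennreal \<beta>"
      using \<beta> by (simp add: ennreal_mult[symmetric] mult.commute)
    also have "ennreal ((norm u)\<^sup>2 / M powr q) = (\<integral>\<^sup>+x. ennreal ((rep_L2 u x)\<^sup>2 / M powr q) \<partial>lborel)"
      using square_integrable_rep_L2[of u] unfolding power2_norm_eq_inner inner_L2.rep_eq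
      by (subst nn_integral_eq_integral) (auto simp: square_integrable_def power2_eq_square)
    also have "\<dots> * ennreal \<beta> = (\<integral>\<^sup>+x. \<integral>\<^sup>+y. ?h (x, y) \<partial>lborel \<partial>lborel)"
    proof -
      have "(\<integral>\<^sup>+y. ?h (x, y) \<partial>lborel) = ennreal ((rep_L2 u x)\<^sup>2 / M powr q) * ennreal \<beta>" for x
        unfolding \<beta>(2)[symmetric] by (simp add: nn_integral_cmult_indicator B_def)
      then show ?thesis by (simp add: nn_integral_multc)
    qed
    also have "\<dots> = (\<integral>\<^sup>+p. ?h p \<partial>(lborel \<Otimes>\<^sub>M lborel))"
      by (rule lborel.nn_integral_fst) measurable
    also have "\<dots> \<le> (\<integral>\<^sup>+p. ennreal ((diff_quotient s u p)\<^sup>2) \<partial>lborel)"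
      unfolding lborel_prod by (rule nn_integral_mono_AE[OF le])
    also have "\<dots> = ennreal ((norm (diff_quotient_L2 s u))\<^sup>2)"
      using sq unfolding power2_norm_eq_inner diff_quotient_L2_def
      by (subst nn_integral_eq_integral)
        (auto simp: square_integrable_def power2_eq_square inner_L2.abs_eq L2_rel_def)
    finally show "\<beta> / M powr q * (norm u)\<^sup>2 \<le> (norm (diff_quotient_L2 s u))\<^sup>2"
      by (simp add: ennreal_le_iff)
  qed
qed

text \<open>
  The space \<open>W0_s2 s \<Omega>\<close> with its graph norm, realized as a subset of a space that is already
  known to be complete: completeness of the energy space becomes closedness of this set.
\<close>

definition energy_graph :: "real \<Rightarrow> 'a::euclidean_space set \<Rightarrow> ('a L2 \<times> ('a \<times> 'a) L2) set" where
  "energy_graph s \<Omega> = (\<lambda>u. (u, diff_quotient_L2 s u)) ` W0_s2 s \<Omega>"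

lemma subspace_energy_graph: "subspace (energy_graph s \<Omega>)"
proof (rule subspaceI)
  have z: "0 \<in> W_s2 s" by (rule zero_in_W_s2)
  have "diff_quotient_L2 s (0 + (-1) *\<^sub>R 0) = diff_quotient_L2 s 0 + (-1) *\<^sub>R diff_quotient_L2 s (0 :: 'a L2)"
    by (rule diff_quotient_comb(2)) (rule z)+
  then have "diff_quotient_L2 s (0 :: 'a L2) = 0" by simp
  moreover have z0: "0 \<in> W0_s2 s \<Omega>" using z by (simp add: W0_s2_eq subspace_0 subspace_L2_on)
  ultimately show "0 \<in> energy_graph s \<Omega>" by (force simp: energy_graph_def zero_prod_def)
  fix c :: real and x assume "x \<in> energy_graph s \<Omega>"
  then obtain u where u: "u \<in> W0_s2 s \<Omega>" "x = (u, diff_quotient_L2 s u)" by (auto simp: energy_graph_def)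
  have "diff_quotient_L2 s (0 + c *\<^sub>R u) = diff_quotient_L2 s 0 + c *\<^sub>R diff_quotient_L2 s u"
    using u z by (intro diff_quotient_comb(2)) (auto simp: W0_s2_eq)
  with \<open>diff_quotient_L2 s (0 :: 'a L2) = 0\<close> show "c *\<^sub>R x \<in> energy_graph s \<Omega>"
    using W0_s2_comb[OF z0 u(1), of c] u by (auto simp: energy_graph_def image_iff)
next
  fix x y assume "x \<in> energy_graph s \<Omega>" "y \<in> energy_graph s \<Omega>"
  then obtain u v where u: "u \<in> W0_s2 s \<Omega>" "x = (u, diff_quotient_L2 s u)"
    and v: "v \<in> W0_s2 s \<Omega>" "y = (v, diff_quotient_L2 s v)" by (auto simp: energy_graph_def)
  have "diff_quotient_L2 s (u + 1 *\<^sub>R v) = diff_quotient_L2 s u + 1 *\<^sub>R diff_quotient_L2 s v"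
    using u v by (intro diff_quotient_comb(2)) (auto simp: W0_s2_eq)
  then show "x + y \<in> energy_graph s \<Omega>"
    using W0_s2_comb[OF u(1) v(1), of 1] u v by (auto simp: energy_graph_def image_iff)
qed

text \<open>
  A common subsequence of the functions and of their difference quotients converges almost everywhere,
  and pointwise the difference quotient of the limit is the limit of the difference quotients.
\<close>

lemma closed_energy_graph: "closed (energy_graph s \<Omega>)"
  unfolding closed_sequential_limits
proof (intro allI impI, elim conjE)
  fix X and l :: "'a L2 \<times> ('a \<times> 'a) L2"
  assume X: "\<forall>n. X n \<in> energy_graph s \<Omega>" "X \<longlonglongrightarrow> l"
  define u where "u n = fst (X n)" for n
  have u: "u n \<in> W0_s2 s \<Omega>" "snd (X n) = diff_quotient_L2 s (u n)" for n
    using X(1) by (auto simp: energy_graph_def u_def dest!: spec[of _ n])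
  have lim1: "u \<longlonglongrightarrow> fst l" unfolding u_def by (rule tendsto_fst[OF X(2)])
  have lim2: "(\<lambda>n. diff_quotient_L2 s (u n)) \<longlonglongrightarrow> snd l"
    using tendsto_snd[OF X(2)] by (simp add: u)
  obtain r where r: "strict_mono r" "AE x in lborel. (\<lambda>n. rep_L2 (u (r n)) x) \<longlonglongrightarrow> rep_L2 (fst l) x"
    using L2_tendsto_AE_subseq[OF lim1] .
  obtain r' where r': "strict_mono r'"
    "AE p in lborel. (\<lambda>n. rep_L2 (diff_quotient_L2 s (u (r (r' n)))) p) \<longlonglongrightarrow> rep_L2 (snd l) p"
    using L2_tendsto_AE_subseq[OF LIMSEQ_subseq_LIMSEQ[OF lim2 r(1)]] by (auto simp: o_def)
  have "\<forall>n. AE p in lborel. rep_L2 (diff_quotient_L2 s (u (r (r' n)))) p = diff_quotient s (u (r (r' n))) p"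
    unfolding diff_quotient_L2_def using u(1) by (auto intro!: AE_rep_abs_L2 simp: W0_s2_eq W_s2_iff)
  then have rep: "AE p in lborel. \<forall>n. rep_L2 (diff_quotient_L2 s (u (r (r' n)))) p = diff_quotient s (u (r (r' n))) p"
    by (rule AE_all_countable[THEN iffD2])
  have ae: "AE p in lborel. rep_L2 (snd l) p = diff_quotient s (fst l) p"
    using AE_lborel_fst[OF r(2), where 'b = 'a] AE_lborel_snd[OF r(2), where 'b = 'a] r'(2) rep
  proof eventually_elim
    case (elim p)
    have "(\<lambda>n. rep_L2 (u (r (r' n))) (fst p)) \<longlonglongrightarrow> rep_L2 (fst l) (fst p)"
      "(\<lambda>n. rep_L2 (u (r (r' n))) (snd p)) \<longlonglongrightarrow> rep_L2 (fst l) (snd p)"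
      using LIMSEQ_subseq_LIMSEQ[OF elim(1) r'(1)] LIMSEQ_subseq_LIMSEQ[OF elim(2) r'(1)]
      by (simp_all add: o_def)
    then have "(\<lambda>n. diff_quotient s (u (r (r' n))) p) \<longlonglongrightarrow> diff_quotient s (fst l) p"
      unfolding diff_quotient_def split_beta divide_inverse by (intro tendsto_intros)
    moreover have "(\<lambda>n. diff_quotient s (u (r (r' n))) p) \<longlonglongrightarrow> rep_L2 (snd l) p"
      using elim by simp
    ultimately show ?case using LIMSEQ_unique by blast
  qed
  have "integrable lborel (\<lambda>p. (rep_L2 (snd l) p)\<^sup>2) \<longleftrightarrow> integrable lborel (\<lambda>p. (diff_quotient s (fst l) p)\<^sup>2)"
    by (rule integrable_cong_AE) (use ae in auto)
  then have sq: "square_integrable (diff_quotient s (fst l))"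
    using square_integrable_rep_L2[of "snd l"] by (simp add: square_integrable_def)
  have "snd l = diff_quotient_L2 s (fst l)"
    unfolding L2_eq_iff diff_quotient_L2_def using ae AE_rep_abs_L2[OF sq] by eventually_elim simp
  moreover have "fst l \<in> L2_on \<Omega>"
    by (rule closed_sequentially[OF closed_L2_on _ lim1]) (use u in \<open>simp add: W0_s2_eq\<close>)
  ultimately show "l \<in> energy_graph s \<Omega>"
    using sq by (auto simp: energy_graph_def W0_s2_eq W_s2_iff image_iff intro!: bexI[of _ "fst l"] prod_eqI)
qed

lemma frac_const_pos: "0 < s \<Longrightarrow> s < 1 \<Longrightarrow> 0 < frac_const N s"
  unfolding frac_const_def by (intro divide_pos_pos mult_pos_pos Gamma_real_pos) auto

text \<open>
  Elements of \<open>L2_on A\<close> vanish outside \<open>A\<close>, so pairings over \<open>A\<close> are inner products of the whole space.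
\<close>

lemma set_integral_L2_on:
  assumes "u \<in> L2_on A \<or> v \<in> L2_on A" "A \<in> sets borel"
  shows "(LINT x:A|lborel. rep_L2 u x * rep_L2 v x) = u \<bullet> v"
  unfolding set_lebesgue_integral_def inner_L2.rep_eq
proof (rule integral_cong_AE)
  show "AE x in lborel. indicator A x *\<^sub>R (rep_L2 u x * rep_L2 v x) = rep_L2 u x * rep_L2 v x"
    using assms(1) unfolding L2_on_def
    by (auto elim!: eventually_mono simp: indicator_def)
qed (use assms(2) in auto)

text \<open>
  Stampacchia's theorem on the graph of the difference quotient, with the form that sees only the
  second component. The Poincare inequality makes this form coercive on the graph, and on a subspace
  the variational inequality is an equality.
\<close>

theorem weak_solution_exists_unique:
  fixes \<Omega> :: "'a::euclidean_space set"
  assumes s: "0 < s" "s < 1" and \<Omega>: "bounded \<Omega>" "\<Omega> \<in> sets borel" and w: "w \<in> L2_on \<Omega>"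
  shows "\<exists>!p. weak_solution s \<Omega> w p"
proof -
  let ?D = "diff_quotient_L2 s" and ?C = "frac_const DIM('a) s / 2" and ?G = "energy_graph s \<Omega>"
  have C: "?C > 0" using frac_const_pos[OF s] by simp
  obtain c where c: "c > 0"
    "\<And>u. u \<in> W0_s2 s \<Omega> \<Longrightarrow> c * (norm u)\<^sup>2 \<le> (norm (?D u))\<^sup>2"
    using fractional_Poincare[OF \<Omega>(1) s(1)] by metis
  have weak: "weak_solution s \<Omega> w p \<longleftrightarrow>
      p \<in> W0_s2 s \<Omega> \<and> (\<forall>\<phi>\<in>W0_s2 s \<Omega>. ?C * (?D p \<bullet> ?D \<phi>) = w \<bullet> \<phi>)" for p
    unfolding weak_solution_def
    using set_integral_L2_on[OF disjI1[OF w] \<Omega>(2)] by (auto simp: frac_form_eq_inner W0_s2_eq)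
  have W0_diff: "u - v \<in> W0_s2 s \<Omega>" "?D (u - v) = ?D u - ?D v"
    if "u \<in> W0_s2 s \<Omega>" "v \<in> W0_s2 s \<Omega>" for u v
    using W0_s2_comb[OF that, of "-1"] diff_quotient_comb(2)[of u s v "-1"] that by (auto simp: W0_s2_eq)
  obtain g where g: "g \<in> ?G" "\<And>v. v \<in> ?G \<Longrightarrow> w \<bullet> fst (v - g) \<le> ?C * (snd g \<bullet> snd (v - g))"
  proof (rule coercive_variational_inequality[of "\<lambda>x y. ?C * (snd x \<bullet> snd y)" "\<lambda>x. w \<bullet> fst x" ?G
        "?C * (c / (1 + c))"])
    show "bounded_bilinear (\<lambda>x y :: 'a L2 \<times> ('a \<times> 'a) L2. ?C * (snd x \<bullet> snd y))"
      using bounded_bilinear.comp[OF bounded_bilinear_inner bounded_linear_snd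
          bounded_linear_compose[OF bounded_linear_scaleR_right[of ?C] bounded_linear_snd]]
      by simp
    show "bounded_linear (\<lambda>x. w \<bullet> fst x)"
      by (rule bounded_linear_compose[OF bounded_linear_inner_right bounded_linear_fst])
    show "complete ?G" using closed_energy_graph by (simp add: complete_eq_closed)
    show "convex ?G" using subspace_energy_graph by (rule subspace_imp_convex)
    show "?G \<noteq> {}" using subspace_0[OF subspace_energy_graph] by blast
    show "?C * (c / (1 + c)) > 0" using C c by simp
    \<comment> \<open>With \<open>c * A \<le> B\<close> for the squared norms \<open>A\<close>, \<open>B\<close> of the components,
      \<open>c / (1 + c) * (A + B) \<le> B\<close>.\<close>
    show "?C * (c / (1 + c)) * (norm (x - y))\<^sup>2 \<le> ?C * (snd (x - y) \<bullet> snd (x - y))"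
      if "x \<in> ?G" "y \<in> ?G" for x y
    proof -
      have "x - y \<in> ?G" using that by (rule subspace_diff[OF subspace_energy_graph])
      then obtain u where u: "u \<in> W0_s2 s \<Omega>" "x - y = (u, ?D u)" by (auto simp: energy_graph_def)
      have "c / (1 + c) * ((norm u)\<^sup>2 + (norm (?D u))\<^sup>2) \<le> (norm (?D u))\<^sup>2"
        using c(1) c(2)[OF u(1)] by (simp add: field_simps)
      then have "?C * (c / (1 + c) * ((norm u)\<^sup>2 + (norm (?D u))\<^sup>2)) \<le> ?C * (norm (?D u))\<^sup>2"
        using C by (intro mult_left_mono) auto
      then show ?thesis by (simp add: u norm_Pair power2_norm_eq_inner mult.assoc)
    qed
  qed (auto simp: inner_commute)
  obtain p where p: "p \<in> W0_s2 s \<Omega>" "g = (p, ?D p)" using g(1) by (auto simp: energy_graph_def)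
  have "?C * (?D p \<bullet> ?D \<phi>) = w \<bullet> \<phi>" if \<phi>: "\<phi> \<in> W0_s2 s \<Omega>" for \<phi>
  proof -
    have f: "(\<phi>, ?D \<phi>) \<in> ?G" using \<phi> by (simp add: energy_graph_def)
    have "w \<bullet> \<phi> \<le> ?C * (?D p \<bullet> ?D \<phi>)"
      using g(2)[OF subspace_add[OF subspace_energy_graph g(1) f]] p by simp
    moreover have "w \<bullet> (- \<phi>) \<le> ?C * (?D p \<bullet> (- ?D \<phi>))"
      using g(2)[OF subspace_diff[OF subspace_energy_graph g(1) f]] p by simp
    ultimately show ?thesis by simp
  qed
  with p have ex: "weak_solution s \<Omega> w p" by (simp add: weak)
  show ?thesis
  proof (rule ex1I[of _ p])
    show "weak_solution s \<Omega> w p" by (rule ex)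
  next
    fix p' assume p': "weak_solution s \<Omega> w p'"
    then have d: "p' - p \<in> W0_s2 s \<Omega>" "?D (p' - p) = ?D p' - ?D p" using W0_diff p by (auto simp: weak)
    have "?C * (?D p' \<bullet> ?D (p' - p)) = ?C * (?D p \<bullet> ?D (p' - p))"
      using ex p' d(1) by (simp add: weak)
    then have "(norm (?D (p' - p)))\<^sup>2 = 0"
      using C by (simp add: d(2) power2_norm_eq_inner inner_diff_left)
    then show "p' = p" using c(1) c(2)[OF d(1)] by (simp add: mult_le_0_iff)
  qed
qed

section \<open>The nonlocal normal derivative and the control-to-state map\<close>

lemma measurable_ext_nonlocal_normal [measurable]:
  assumes [measurable]: "\<Omega> \<in> sets borel"
  shows "ext_nonlocal_normal s \<Omega> u \<in> borel_measurable lborel"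
  unfolding ext_nonlocal_normal_def[abs_def] nonlocal_normal_def[abs_def] set_lebesgue_integral_def
  by measurable

text \<open>
  With both pairings over the whole space, the defining identity depends only on the classes of \<open>u\<close> and
  \<open>w\<close>, and almost everywhere identities for the datum can be substituted under the integral.
\<close>

lemma very_weak_solution_iff:
  assumes "\<Omega> \<in> sets borel"
  shows "very_weak_solution s \<Omega> z u \<longleftrightarrow>
    (AE x in lborel. x \<in> - \<Omega> \<longrightarrow> rep_L2 u x = rep_L2 z x) \<and>
    (\<forall>v. \<forall>w\<in>L2_on \<Omega>. weak_solution s \<Omega> w v \<longrightarrow>
       integrable lborel (\<lambda>x. rep_L2 z x * ext_nonlocal_normal s \<Omega> v x) \<and>
       u \<bullet> w = - (LBINT x. rep_L2 z x * ext_nonlocal_normal s \<Omega> v x))"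
proof -
  have eq: "indicator (- \<Omega>) x *\<^sub>R (rep_L2 z x * nonlocal_normal s \<Omega> v x)
      = rep_L2 z x * ext_nonlocal_normal s \<Omega> v x" for v x
    by (simp add: ext_nonlocal_normal_def)
  show ?thesis
    unfolding very_weak_solution_def set_integrable_def set_lebesgue_integral_def[of _ "- \<Omega>"] eq
    using assms by (simp add: set_integral_L2_on)
qed

text \<open>
  Solvability for every exterior datum forces the normal derivative to have an integrable product with
  every square-integrable function on the complement of \<open>\<Omega>\<close>. The converse of Hoelder's inequality turns
  this into square integrability.
\<close>

lemma square_integrable_nonlocal_normal:
  assumes wd: "\<forall>z\<in>L2_on (- \<Omega>). \<exists>u. very_weak_solution s \<Omega> z u"
    and \<Omega> [measurable]: "\<Omega> \<in> sets borel" and w: "w \<in> L2_on \<Omega>" "weak_solution s \<Omega> w p"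
  shows "square_integrable (ext_nonlocal_normal s \<Omega> p)"
proof (rule square_integrable_if_products_integrable)
  fix f :: "'a \<Rightarrow> real" assume f: "square_integrable f"
  then have f_meas [measurable]: "f \<in> borel_measurable borel" by (simp add: square_integrable_def)
  have comp: "- \<Omega> \<in> sets borel" by (simp add: \<Omega> borel_comp)
  define z where "z = restrict_L2 (- \<Omega>) (abs_L2 f)"
  have "z \<in> L2_on (- \<Omega>)" unfolding z_def using comp by (rule restrict_L2_in_L2_on)
  then have int: "integrable lborel (\<lambda>x. rep_L2 z x * ext_nonlocal_normal s \<Omega> p x)"
    using wd w unfolding very_weak_solution_iff[OF \<Omega>] by blast
  have "AE x in lborel. rep_L2 z x * ext_nonlocal_normal s \<Omega> p x = f x * ext_nonlocal_normal s \<Omega> p x"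
    using AE_rep_restrict_L2[OF comp, of "abs_L2 f"] AE_rep_abs_L2[OF f]
    by eventually_elim (auto simp: z_def ext_nonlocal_normal_def indicator_def)
  then show "integrable lborel (\<lambda>x. f x * ext_nonlocal_normal s \<Omega> p x)"
    by (intro integrable_cong_AE_imp[OF int]) (auto elim!: eventually_mono)
qed measurable

lemma very_weak_solution_comb:
  assumes \<Omega> [measurable]: "\<Omega> \<in> sets borel"
    and u: "very_weak_solution s \<Omega> z u" and u': "very_weak_solution s \<Omega> z' u'"
  shows "very_weak_solution s \<Omega> (z + c *\<^sub>R z') (u + c *\<^sub>R u')"
proof -
  have comb: "AE x in lborel. rep_L2 (a + c *\<^sub>R b) x = rep_L2 a x + c * rep_L2 b x" for a b :: "'a L2"
    using AE_rep_L2_add[of a "c *\<^sub>R b"] AE_rep_L2_scaleR[of c b] by eventually_elim simp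
  have "AE x in lborel. x \<in> - \<Omega> \<longrightarrow> rep_L2 u x = rep_L2 z x"
    "AE x in lborel. x \<in> - \<Omega> \<longrightarrow> rep_L2 u' x = rep_L2 z' x"
    using u u' by (auto simp: very_weak_solution_def)
  then have outside: "AE x in lborel. x \<in> - \<Omega> \<longrightarrow> rep_L2 (u + c *\<^sub>R u') x = rep_L2 (z + c *\<^sub>R z') x"
    using comb[of u u'] comb[of z z'] by eventually_elim auto
  have "integrable lborel (\<lambda>x. rep_L2 (z + c *\<^sub>R z') x * ext_nonlocal_normal s \<Omega> v x) \<and>
      (u + c *\<^sub>R u') \<bullet> w = - (LBINT x. rep_L2 (z + c *\<^sub>R z') x * ext_nonlocal_normal s \<Omega> v x)"
    if w: "w \<in> L2_on \<Omega>" "weak_solution s \<Omega> w v" for v w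
  proof -
    let ?E = "ext_nonlocal_normal s \<Omega> v"
    have int: "integrable lborel (\<lambda>x. rep_L2 z x * ?E x)" "integrable lborel (\<lambda>x. rep_L2 z' x * ?E x)"
      and val: "u \<bullet> w = - (LBINT x. rep_L2 z x * ?E x)" "u' \<bullet> w = - (LBINT x. rep_L2 z' x * ?E x)"
      using u u' w unfolding very_weak_solution_iff[OF \<Omega>] by blast+
    have int': "integrable lborel (\<lambda>x. rep_L2 z x * ?E x + c * (rep_L2 z' x * ?E x))"
      using int by auto
    have ae: "AE x in lborel. rep_L2 (z + c *\<^sub>R z') x * ?E x = rep_L2 z x * ?E x + c * (rep_L2 z' x * ?E x)"
      using comb[of z z'] by eventually_elim (simp add: algebra_simps)
    have "integrable lborel (\<lambda>x. rep_L2 (z + c *\<^sub>R z') x * ?E x)"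
      by (rule integrable_cong_AE_imp[OF int']) (use ae in auto)
    moreover have "(LBINT x. rep_L2 (z + c *\<^sub>R z') x * ?E x)
        = (LBINT x. rep_L2 z x * ?E x + c * (rep_L2 z' x * ?E x))"
      by (rule integral_cong_AE) (use ae in auto)
    moreover have "\<dots> = (LBINT x. rep_L2 z x * ?E x) + c * (LBINT x. rep_L2 z' x * ?E x)"
      using int by simp
    ultimately show ?thesis by (simp add: inner_add_left val)
  qed
  with outside show ?thesis by (simp add: very_weak_solution_iff[OF \<Omega>])
qed

text \<open>
  The difference of two solutions vanishes outside \<open>\<Omega>\<close>, so it is itself an admissible right-hand side
  \<open>w\<close>; testing with the corresponding weak solution shows that it is orthogonal to itself.
\<close>

lemma very_weak_solution_unique:
  assumes s: "0 < s" "s < 1" and \<Omega>: "bounded \<Omega>" "\<Omega> \<in> sets borel"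
    and u: "very_weak_solution s \<Omega> z u" "very_weak_solution s \<Omega> z u'"
  shows "u = u'"
proof -
  have "AE x in lborel. x \<in> - \<Omega> \<longrightarrow> rep_L2 u x = rep_L2 z x"
    "AE x in lborel. x \<in> - \<Omega> \<longrightarrow> rep_L2 u' x = rep_L2 z x"
    using u by (auto simp: very_weak_solution_def)
  then have "AE x in lborel. x \<notin> \<Omega> \<longrightarrow> rep_L2 (u - u') x = 0"
    using AE_rep_L2_diff[of u u'] by eventually_elim auto
  then have d: "u - u' \<in> L2_on \<Omega>" by (simp add: L2_on_def)
  then obtain v where v: "weak_solution s \<Omega> (u - u') v"
    using weak_solution_exists_unique[OF s \<Omega>] by blast
  have "u \<bullet> (u - u') = u' \<bullet> (u - u')"
    using u v d unfolding very_weak_solution_iff[OF \<Omega>(2)] by metis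
  then have "(u - u') \<bullet> (u - u') = 0" by (simp only: inner_diff_left)
  then show ?thesis by simp
qed

lemma control_to_state_eq:
  assumes "0 < s" "s < 1" "bounded \<Omega>" "\<Omega> \<in> sets borel" "very_weak_solution s \<Omega> z u"
  shows "control_to_state s \<Omega> z = restrict_L2 \<Omega> u"
  unfolding control_to_state_def
  using the_equality[of "very_weak_solution s \<Omega> z" u] very_weak_solution_unique[OF assms(1-4)] assms(5)
  by metis

lemma restrict_L2_comb:
  assumes "A \<in> sets borel"
  shows "restrict_L2 A (u + c *\<^sub>R v) = restrict_L2 A u + c *\<^sub>R restrict_L2 A v"
  unfolding L2_eq_iff
  using AE_rep_restrict_L2[OF assms, of "u + c *\<^sub>R v"] AE_rep_restrict_L2[OF assms, of u]
    AE_rep_restrict_L2[OF assms, of v] AE_rep_L2_add[of u "c *\<^sub>R v"] AE_rep_L2_scaleR[of c v]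
    AE_rep_L2_add[of "restrict_L2 A u" "c *\<^sub>R restrict_L2 A v"] AE_rep_L2_scaleR[of c "restrict_L2 A v"]
  by eventually_elim (simp add: algebra_simps)

lemma inner_restrict_L2:
  assumes "A \<in> sets borel" "w \<in> L2_on A"
  shows "w \<bullet> restrict_L2 A u = w \<bullet> u"
  unfolding inner_L2.rep_eq
proof (rule integral_cong_AE)
  have "AE x in lborel. x \<notin> A \<longrightarrow> rep_L2 w x = 0" using assms(2) by (simp add: L2_on_def)
  then show "AE x in lborel. rep_L2 w x * rep_L2 (restrict_L2 A u) x = rep_L2 w x * rep_L2 u x"
    using AE_rep_restrict_L2[OF assms(1), of u] by eventually_elim (auto simp: indicator_def)
qed auto

lemma control_to_state_comb:
  assumes s: "0 < s" "s < 1" and \<Omega>: "bounded \<Omega>" "\<Omega> \<in> sets borel"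
    and wd: "\<forall>z\<in>L2_on (- \<Omega>). \<exists>u. very_weak_solution s \<Omega> z u"
    and z: "z \<in> L2_on (- \<Omega>)" "z' \<in> L2_on (- \<Omega>)"
  shows "control_to_state s \<Omega> (z + c *\<^sub>R z') = control_to_state s \<Omega> z + c *\<^sub>R control_to_state s \<Omega> z'"
proof -
  obtain u u' where u: "very_weak_solution s \<Omega> z u" "very_weak_solution s \<Omega> z' u'"
    using wd z by blast
  show ?thesis
    using control_to_state_eq[OF s \<Omega> u(1)] control_to_state_eq[OF s \<Omega> u(2)]
      control_to_state_eq[OF s \<Omega> very_weak_solution_comb[OF \<Omega>(2) u, of c]]
      restrict_L2_comb[OF \<Omega>(2), of u c u'] by simp
qed

text \<open>
  The adjoint of the control-to-state map is $w \mapsto -\mathcal{N}_s p$: the weak solution \<open>p\<close> for the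
  right-hand side \<open>w\<close> is the test function in the definition of the very weak solution.
\<close>

lemma control_to_state_adjoint:
  assumes s: "0 < s" "s < 1" and \<Omega>: "bounded \<Omega>" "\<Omega> \<in> sets borel"
    and wd: "\<forall>z\<in>L2_on (- \<Omega>). \<exists>u. very_weak_solution s \<Omega> z u"
    and z: "z \<in> L2_on (- \<Omega>)" and w: "w \<in> L2_on \<Omega>" "weak_solution s \<Omega> w p"
  shows "w \<bullet> control_to_state s \<Omega> z = - nonlocal_normal_L2 s \<Omega> p \<bullet> z"
proof -
  obtain u where u: "very_weak_solution s \<Omega> z u" using wd z by blast
  have "w \<bullet> control_to_state s \<Omega> z = u \<bullet> w"
    using control_to_state_eq[OF s \<Omega> u] inner_restrict_L2[OF \<Omega>(2) w(1)] by (simp add: inner_commute)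
  also have "\<dots> = - (LBINT x. rep_L2 z x * ext_nonlocal_normal s \<Omega> p x)"
    using u w unfolding very_weak_solution_iff[OF \<Omega>(2)] by blast
  also have "(LBINT x. rep_L2 z x * ext_nonlocal_normal s \<Omega> p x) = nonlocal_normal_L2 s \<Omega> p \<bullet> z"
    unfolding inner_L2.rep_eq nonlocal_normal_L2_def
  proof (rule integral_cong_AE)
    show "AE x in lborel. rep_L2 z x * ext_nonlocal_normal s \<Omega> p x
        = rep_L2 (abs_L2 (ext_nonlocal_normal s \<Omega> p)) x * rep_L2 z x"
      using AE_rep_abs_L2[OF square_integrable_nonlocal_normal[OF wd \<Omega>(2) w]]
      by eventually_elim simp
  qed (use \<Omega> in measurable)
  also have "- (nonlocal_normal_L2 s \<Omega> p \<bullet> z) = - nonlocal_normal_L2 s \<Omega> p \<bullet> z" by simp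
  finally show ?thesis .
qed

section \<open>First order optimality conditions\<close>

text \<open>
  Along the segment from \<open>zb\<close> to \<open>z\<close> the state is affine in the parameter, and the adjoint identity rewrites
  the slope of the reduced cost at \<open>zb\<close> as the left-hand side of the variational inequality. The projection
  formula is the same inequality divided by \<open>\<xi>\<close>.
\<close>

theorem theorem4p3:
  fixes \<Omega> :: "'a::euclidean_space set"
    and s \<xi> :: real
    and Zad Z :: "'a L2 set"
    and J :: "'a L2 \<Rightarrow> real"
    and J' :: "'a L2 \<Rightarrow> 'a L2"
  assumes "0 < s" and "s < 1"
    and "open \<Omega>" and "connected \<Omega>" and "\<Omega> \<noteq> {}" and "bounded \<Omega>" and "lipschitz_boundary \<Omega>"
    and "\<xi> > 0"
    and S_well_defined: "\<forall>z\<in>L2_on (- \<Omega>). \<exists>u. very_weak_solution s \<Omega> z u"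
    and "closedin (top_of_set (L2_on (- \<Omega>))) Zad" and "convex Zad"
    and "weakly_lsc_on (L2_on \<Omega>) J"
    and "openin (top_of_set (L2_on (- \<Omega>))) Z" and "Zad \<subseteq> Z"
    and "\<forall>u\<in>L2_on \<Omega>. J' u \<in> L2_on \<Omega> \<and>
           (J has_derivative (\<lambda>h. J' u \<bullet> h)) (at u within L2_on \<Omega>)"
    and "continuous_on (L2_on \<Omega>) J'"
  shows "\<forall>zb\<in>Zad.
      (\<exists>!p. weak_solution s \<Omega> (J' (control_to_state s \<Omega> zb)) p) \<and>
      (\<forall>p. weak_solution s \<Omega> (J' (control_to_state s \<Omega> zb)) p \<longrightarrow>
         square_integrable (ext_nonlocal_normal s \<Omega> p) \<and>
         (is_arg_min (reduced_cost s \<Omega> \<xi> J) (\<lambda>z. z \<in> Zad) zb \<longrightarrow>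
            variational_inequality s \<Omega> \<xi> Zad zb p) \<and>
         (variational_inequality s \<Omega> \<xi> Zad zb p \<longleftrightarrow>
            zb = projection Zad ((1 / \<xi>) *\<^sub>R nonlocal_normal_L2 s \<Omega> p)) \<and>
         (convex_on (L2_on \<Omega>) J \<longrightarrow> variational_inequality s \<Omega> \<xi> Zad zb p \<longrightarrow>
            is_arg_min (reduced_cost s \<Omega> \<xi> J) (\<lambda>z. z \<in> Zad) zb))"
proof (intro ballI conjI allI impI)
  fix zb assume zb: "zb \<in> Zad"
  let ?S = "control_to_state s \<Omega>" and ?F = "reduced_cost s \<Omega> \<xi> J"
  define u where "u = ?S zb"
  note s = \<open>0 < s\<close> \<open>s < 1\<close>
  have borel: "\<Omega> \<in> sets borel" using \<open>open \<Omega>\<close> by simp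
  note \<Omega> = \<open>bounded \<Omega>\<close> borel
  have Zad: "complete Zad" "Zad \<subseteq> L2_on (- \<Omega>)"
    using closedin_closed_trans[OF \<open>closedin (top_of_set (L2_on (- \<Omega>))) Zad\<close> closed_L2_on]
      closedin_imp_subset[OF \<open>closedin (top_of_set (L2_on (- \<Omega>))) Zad\<close>]
    by (auto simp: complete_eq_closed)
  have S_in: "?S z \<in> L2_on \<Omega>" for z
    unfolding control_to_state_def using borel by (rule restrict_L2_in_L2_on)
  have J': "J' u \<in> L2_on \<Omega>" "(J has_derivative (\<lambda>h. J' u \<bullet> h)) (at u within L2_on \<Omega>)"
    using assms(15) S_in unfolding u_def by auto
  have dir: "z - zb \<in> L2_on (- \<Omega>)" if "z \<in> Zad" for z
    using that zb Zad subspace_diff[OF subspace_L2_on] by blast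
  have S_line: "?S (zb + t *\<^sub>R (z - zb)) = u + t *\<^sub>R ?S (z - zb)" if "z \<in> Zad" for z t
    unfolding u_def using zb Zad dir[OF that] by (intro control_to_state_comb s \<Omega> S_well_defined) auto
  show "\<exists>!p. weak_solution s \<Omega> (J' (?S zb)) p"
    using weak_solution_exists_unique[OF s \<Omega> J'(1)] by (simp add: u_def)
  fix p assume "weak_solution s \<Omega> (J' (?S zb)) p"
  then have p: "weak_solution s \<Omega> (J' u) p" by (simp add: u_def)
  show "square_integrable (ext_nonlocal_normal s \<Omega> p)"
    by (rule square_integrable_nonlocal_normal[OF S_well_defined borel J'(1) p])
  let ?N = "nonlocal_normal_L2 s \<Omega> p"
  have gradient: "(- ?N + \<xi> *\<^sub>R zb) \<bullet> (z - zb) = J' u \<bullet> ?S (z - zb) + \<xi> * (zb \<bullet> (z - zb))"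
    if "z \<in> Zad" for z
    using control_to_state_adjoint[OF s \<Omega> S_well_defined dir[OF that] J'(1) p]
    by (simp only: inner_add_left inner_scaleR_left)
  have square: "(norm (zb + t *\<^sub>R h))\<^sup>2 = (norm zb)\<^sup>2 + 2 * t * (zb \<bullet> h) + t * t * (norm h)\<^sup>2" for t h
    unfolding power2_norm_eq_inner by (simp add: inner_simps inner_commute algebra_simps)
  {
    assume min: "is_arg_min ?F (\<lambda>z. z \<in> Zad) zb"
    show "variational_inequality s \<Omega> \<xi> Zad zb p"
      unfolding variational_inequality_def
    proof
      fix z assume z: "z \<in> Zad"
      let ?h = "z - zb"
      let ?f = "\<lambda>t. J (u + t *\<^sub>R ?S ?h) + \<xi> / 2 * ((norm zb)\<^sup>2 + 2 * t * (zb \<bullet> ?h) + t * t * (norm ?h)\<^sup>2)"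
      have f: "?F (zb + t *\<^sub>R ?h) = ?f t" for t
        by (simp only: reduced_cost_def S_line[OF z] square)
      have "((\<lambda>t. J (u + t *\<^sub>R ?S ?h)) has_real_derivative J' u \<bullet> ?S ?h) (at 0)"
        using directional_derivative[OF J'(2) subspace_L2_on] S_in by (simp add: u_def)
      then have "(?f has_real_derivative J' u \<bullet> ?S ?h + \<xi> * (zb \<bullet> ?h)) (at 0)"
        by (auto intro!: derivative_eq_intros)
      then have "0 \<le> J' u \<bullet> ?S ?h + \<xi> * (zb \<bullet> ?h)"
      proof (rule right_minimum_derivative_nonneg)
        fix t :: real assume t: "0 \<le> t" "t \<le> 1"
        have "(1 - t) *\<^sub>R zb + t *\<^sub>R z \<in> Zad"
          using \<open>convex Zad\<close> zb z t by (intro convexD) auto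
        moreover have "(1 - t) *\<^sub>R zb + t *\<^sub>R z = zb + t *\<^sub>R ?h" by (simp add: algebra_simps)
        ultimately have "?F zb \<le> ?F (zb + t *\<^sub>R ?h)"
          using min by (auto simp: is_arg_min_def not_less)
        then show "?f 0 \<le> ?f t" using f[of 0] f[of t] by simp
      qed
      then show "0 \<le> (- ?N + \<xi> *\<^sub>R zb) \<bullet> (z - zb)" by (simp only: gradient[OF z])
    qed
  next
    have "(- ?N + \<xi> *\<^sub>R zb) \<bullet> (z - zb) = \<xi> * ((zb - (1 / \<xi>) *\<^sub>R ?N) \<bullet> (z - zb))" for z
      using \<open>\<xi> > 0\<close> by (simp add: inner_add_left inner_diff_left right_diff_distrib)
    then show "variational_inequality s \<Omega> \<xi> Zad zb p \<longleftrightarrow> zb = projection Zad ((1 / \<xi>) *\<^sub>R ?N)"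
      using projection_iff_variational_inequality[OF Zad(1) \<open>convex Zad\<close> zb] \<open>\<xi> > 0\<close>
      by (simp add: variational_inequality_def zero_le_mult_iff)
  next
    assume conv: "convex_on (L2_on \<Omega>) J" and VI: "variational_inequality s \<Omega> \<xi> Zad zb p"
    have "?F zb \<le> ?F z" if z: "z \<in> Zad" for z
    proof -
      let ?h = "z - zb"
      have Sz: "?S z = u + ?S ?h" using S_line[OF z, of 1] by simp
      have "J u + J' u \<bullet> (?S z - u) \<le> J (?S z)"
        using convex_imp_above_tangent[OF J'(2) subspace_L2_on _ S_in conv] S_in by (simp add: u_def)
      moreover have "(norm z)\<^sup>2 = (norm zb)\<^sup>2 + 2 * (zb \<bullet> ?h) + (norm ?h)\<^sup>2"
        using square[of 1 ?h] by simp
      then have "\<xi> / 2 * ((norm zb)\<^sup>2 + 2 * (zb \<bullet> ?h)) \<le> \<xi> / 2 * (norm z)\<^sup>2"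
        using \<open>\<xi> > 0\<close> by (intro mult_left_mono) auto
      then have "\<xi> / 2 * (norm zb)\<^sup>2 + \<xi> * (zb \<bullet> ?h) \<le> \<xi> / 2 * (norm z)\<^sup>2"
        by (simp add: distrib_left)
      moreover have "0 \<le> J' u \<bullet> ?S ?h + \<xi> * (zb \<bullet> ?h)"
        using VI z unfolding variational_inequality_def gradient[OF z, symmetric] by blast
      ultimately show ?thesis by (simp add: reduced_cost_def Sz flip: u_def)
    qed
    then show "is_arg_min ?F (\<lambda>z. z \<in> Zad) zb"
      using zb by (auto simp: is_arg_min_def not_less)
  }
qed

end
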